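(* Let $E$ be a (real or complex) Banach lattice and let $(e^{tA})_{t\ge 0}$ be a positive $C_0$-semigroup on $E$ (i.e. $e^{tA}E_+\subseteq E_+$ for all $t\ge 0$). Then the following five conditions are equivalent: (i) $(e^{tA})_{t\ge 0}$ is irreducible. (ii) For each $0\lneq f\in E$ and each $0\lneq\varphi\in E'$ there exists $t\in[0,\infty)$ such that $\langle\varphi,e^{tA}f\rangle\neq 0$. (iii) $(e^{tA})_{t\ge 0}$ is persistently irreducible. (iv) For each $0\lneq f\in E$, each $0\lneq\varphi\in E'$ and each $t_0\in[0,\infty)$ there exists $t\in\{0\}\cup[t_0,\infty)$ such that $\langle\varphi,e^{tA}f\rangle\neq 0$. (v) For each $0\lneq f\in E$, each $0\lneq\varphi\in E'$ and each $t_0\in[0,\infty)$ there exists $t\in[t_0,\infty)$ such that $\langle\varphi,e^{tA}f\rangle\neq 0$.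
   Context: Notation: $E_+$ is the positive cone; $f\gneq 0$ (or $0 \lneq f$) means $f\ge 0$ and $f\ne 0$; $E'$ is the dual Banach lattice. A $C_0$-semigroup $(e^{tA})_{t\ge0}$ on $E$ is irreducible if no closed ideal $I$ of $E$ other than $\{0\}$ and $E$ satisfies $e^{tA}I\subseteq I$ for all $t\ge 0$. It is persistently irreducible if no closed ideal $I$ other than $\{0\}$ and $E$ is uniformly eventually invariant, i.e. satisfies: there is $t_0\ge0$ with $e^{tA}I\subseteq I$ for all $t\ge t_0$. *)

theory Defs
  imports "HOL-Analysis.Analysis" "HOL-Library.Lattice_Algebras"
begin

section \<open>Real Banach lattices\<close>

class banach_lattice = banach + ordered_real_vector + lattice_ab_group_add_abs +
  assumes norm_mono: "\<bar>x\<bar> \<le> \<bar>y\<bar> \<Longrightarrow> norm x \<le> norm y"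

instance real :: banach_lattice
  by standard simp

lemma norm_abs_lattice [simp]: "norm \<bar>x\<bar> = norm x" for x :: "'a::banach_lattice"
  by (intro antisym norm_mono) simp_all

lemma norm_mono_pos: "0 \<le> x \<Longrightarrow> x \<le> y \<Longrightarrow> norm x \<le> norm y"
  for x y :: "'a::banach_lattice"
  by (rule norm_mono) (metis abs_of_nonneg order_trans)

lemma nonneg_lim:
  fixes x :: "'a::banach_lattice"
  assumes lim: "X \<longlonglongrightarrow> x" and nonneg: "\<And>n. 0 \<le> X n"
  shows "0 \<le> x"
proof -
  have "norm (sup (- x) 0) \<le> norm (X n - x)" for n
  proof -
    have "- x \<le> X n - x"
      using nonneg[of n] by simp
    also have "\<dots> \<le> \<bar>X n - x\<bar>"
      by (rule abs_ge_self)
    finally have "sup (- x) 0 \<le> \<bar>X n - x\<bar>"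
      by simp
    then show ?thesis
      using norm_mono_pos[of "sup (- x) 0" "\<bar>X n - x\<bar>"] by simp
  qed
  moreover have "(\<lambda>n. norm (X n - x)) \<longlonglongrightarrow> 0"
    using lim by (simp add: LIM_zero_iff tendsto_norm_zero)
  ultimately have "norm (sup (- x) 0) \<le> 0"
    by (intro LIMSEQ_le_const) auto
  then have "sup (- x) 0 = 0"
    by simp
  then have "- x \<le> 0"
    by (metis sup_ge1)
  then show ?thesis
    by simp
qed


section \<open>Complex Banach lattices\<close>

text \<open>
  A complex Banach lattice is the complexification \<open>E = E\<^sub>\<real> \<oplus> i E\<^sub>\<real>\<close> of a real Banach lattice
  \<open>E\<^sub>\<real>\<close>; its modulus is \<open>|z| = sup {Re (c z) : c \<in> \<complex>, |c| = 1}\<close>, the supremum being taken in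
  \<open>E\<^sub>\<real>\<close>, and its norm is \<open>\<parallel>z\<parallel> = \<parallel>|z|\<parallel>\<close>.
\<close>

codatatype 'a complexification = Cplx (re_part: 'a) (im_part: 'a)

lemma complexification_eq_iff: "z = w \<longleftrightarrow> re_part z = re_part w \<and> im_part z = im_part w"
  by (auto intro: complexification.expand)

instantiation complexification :: (real_vector) real_vector
begin

primcorec zero_complexification where
  "re_part 0 = 0"
| "im_part 0 = 0"

primcorec plus_complexification where
  "re_part (z + w) = re_part z + re_part w"
| "im_part (z + w) = im_part z + im_part w"

primcorec uminus_complexification where
  "re_part (- z) = - re_part z"
| "im_part (- z) = - im_part z"

primcorec minus_complexification where
  "re_part (z - w) = re_part z - re_part w"
| "im_part (z - w) = im_part z - im_part w"

primcorec scaleR_complexification where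
  "re_part (r *\<^sub>R z) = r *\<^sub>R re_part z"
| "im_part (r *\<^sub>R z) = r *\<^sub>R im_part z"

instance
  by standard (simp_all add: complexification_eq_iff scaleR_add_left scaleR_add_right)

end

primcorec scaleC :: "complex \<Rightarrow> 'a::real_vector complexification \<Rightarrow> 'a complexification" where
  "re_part (scaleC c z) = Re c *\<^sub>R re_part z - Im c *\<^sub>R im_part z"
| "im_part (scaleC c z) = Re c *\<^sub>R im_part z + Im c *\<^sub>R re_part z"

lemma vector_space_scaleC: "vector_space scaleC"
  by standard (simp_all add: complexification_eq_iff algebra_simps)

lemma scaleC_of_real: "scaleC (of_real r) z = r *\<^sub>R z"
  by (simp add: complexification_eq_iff)

lemma scaleC_scaleC: "scaleC a (scaleC b z) = scaleC (a * b) z"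
  by (simp add: complexification_eq_iff algebra_simps)

text \<open>\<open>f \<le> g\<close> iff \<open>g - f\<close> belongs to the positive cone of \<open>E\<^sub>\<real>\<close>.\<close>

instantiation complexification :: (order) order
begin

definition less_eq_complexification_def:
  "(f :: 'a complexification) \<le> g \<longleftrightarrow> re_part f \<le> re_part g \<and> im_part f = im_part g"

definition less_complexification_def:
  "(f :: 'a complexification) < g \<longleftrightarrow> f \<le> g \<and> f \<noteq> g"

instance
  by standard
    (auto simp: less_eq_complexification_def less_complexification_def complexification_eq_iff)

end

instance complexification :: (ordered_real_vector) ordered_real_vector
  by standard
    (auto simp: less_eq_complexification_def complexification_eq_iff
      intro: scaleR_left_mono scaleR_right_mono)

definition modulus :: "'a::banach_lattice complexification \<Rightarrow> 'a" where
  "modulus z = (THE s. (\<forall>c. cmod c = 1 \<longrightarrow> re_part (scaleC c z) \<le> s) \<and>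
                       (\<forall>u. (\<forall>c. cmod c = 1 \<longrightarrow> re_part (scaleC c z) \<le> u) \<longrightarrow> s \<le> u))"

lemma modulus_exists:
  fixes z :: "'a::banach_lattice complexification"
  shows "\<exists>s. (\<forall>c. cmod c = 1 \<longrightarrow> re_part (scaleC c z) \<le> s) \<and>
             (\<forall>u. (\<forall>c. cmod c = 1 \<longrightarrow> re_part (scaleC c z) \<le> u) \<longrightarrow> s \<le> u)"
proof -
  define g where "g c = re_part (scaleC c z)" for c
  define v where "v = \<bar>re_part z\<bar> + \<bar>im_part z\<bar>"
  define e where "e n = inverse (real (Suc n))" for n
  have e_pos: "0 < e n" for n
    by (simp add: e_def)
  have v_nonneg: "0 \<le> v"
    by (simp add: v_def)
  have g_close: "g c \<le> g d + r *\<^sub>R v" if "cmod (c - d) < r" for c d r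
  proof -
    have part: "a *\<^sub>R x \<le> r *\<^sub>R \<bar>x\<bar>" if "\<bar>a\<bar> \<le> r" for a and x :: 'a
    proof (cases "0 \<le> a")
      case True
      have "a *\<^sub>R x \<le> a *\<^sub>R \<bar>x\<bar>"
        by (rule scaleR_left_mono[OF abs_ge_self True])
      also have "\<dots> \<le> r *\<^sub>R \<bar>x\<bar>"
        by (rule scaleR_right_mono) (use that in auto)
      finally show ?thesis .
    next
      case False
      have "(- a) *\<^sub>R (- x) \<le> (- a) *\<^sub>R \<bar>x\<bar>"
        by (rule scaleR_left_mono[OF abs_ge_minus_self]) (use False in simp)
      also have "\<dots> \<le> r *\<^sub>R \<bar>x\<bar>"
        by (rule scaleR_right_mono) (use that in auto)
      finally show ?thesis
        by simp
    qed
    have "\<bar>Re (c - d)\<bar> \<le> r" "\<bar>- Im (c - d)\<bar> \<le> r"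
      using that abs_Re_le_cmod[of "c - d"] abs_Im_le_cmod[of "c - d"] by simp_all
    from add_mono[OF part[OF this(1), of "re_part z"] part[OF this(2), of "im_part z"]]
    show ?thesis
      by (simp add: g_def v_def algebra_simps)
  qed
  have "\<exists>k. finite k \<and> k \<subseteq> sphere (0::complex) 1 \<and> sphere 0 1 \<subseteq> (\<Union>x\<in>k. ball x (e n))" for n
    by (rule seq_compact_imp_totally_bounded[rule_format])
      (simp_all add: compact_imp_seq_compact e_pos)
  then obtain k where k: "\<And>n. finite (k n)" "\<And>n. k n \<subseteq> sphere (0::complex) 1"
      "\<And>n. sphere 0 1 \<subseteq> (\<Union>x\<in>k n. ball x (e n))"
    by metis
  define s where "s n = Sup_fin (g ` k n)" for n
  have k_ne: "k n \<noteq> {}" for n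
  proof
    assume "k n = {}"
    then have "(1::complex) \<notin> sphere 0 1"
      using k(3)[of n] by auto
    then show False
      by simp
  qed
  have g_le_s: "g c \<le> s n + e n *\<^sub>R v" if c: "cmod c = 1" for c n
  proof -
    have "c \<in> (\<Union>x\<in>k n. ball x (e n))"
      by (rule subsetD[OF k(3)]) (simp add: c)
    then obtain d where d: "d \<in> k n" "dist d c < e n"
      by auto
    have "g c \<le> g d + e n *\<^sub>R v"
      by (rule g_close) (use d(2) in \<open>simp add: dist_norm norm_minus_commute\<close>)
    also have "g d \<le> s n"
      unfolding s_def by (rule Sup_fin.coboundedI) (use k(1) d in auto)
    finally show ?thesis
      by simp
  qed
  have s_least: "s n \<le> u" if "\<And>c. cmod c = 1 \<Longrightarrow> g c \<le> u" for n u
    unfolding s_def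
    by (rule Sup_fin.boundedI) (use k(1)[of n] k_ne[of n] subsetD[OF k(2)[of n]] in \<open>auto intro!: that\<close>)
  have s_diff: "\<bar>s m - s n\<bar> \<le> e N *\<^sub>R v" if "N \<le> m" "N \<le> n" for m n N
  proof -
    have le: "s m - s n \<le> e N *\<^sub>R v" if "N \<le> n" for m n
    proof -
      have "s m \<le> s n + e n *\<^sub>R v"
        by (rule s_least) (rule g_le_s)
      also have "e n *\<^sub>R v \<le> e N *\<^sub>R v"
        by (rule scaleR_right_mono[OF _ v_nonneg]) (use that in \<open>simp add: e_def\<close>)
      finally show ?thesis
        by (simp add: algebra_simps)
    qed
    show ?thesis
      using le[OF that(1), of n] le[OF that(2), of m] by (intro abs_leI) simp_all
  qed
  have e_lim: "e \<longlonglongrightarrow> 0"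
    unfolding e_def by (rule LIMSEQ_inverse_real_of_nat)
  have "Cauchy s"
  proof (rule metric_CauchyI)
    fix r :: real
    assume "0 < r"
    have "(\<lambda>n. e n * norm v) \<longlonglongrightarrow> 0"
      using tendsto_mult_left_zero[OF e_lim] .
    then have "\<forall>\<^sub>F n in sequentially. e n * norm v < r"
      using \<open>0 < r\<close> by (rule order_tendstoD)
    then obtain N where N: "e N * norm v < r"
      by (auto simp: eventually_sequentially)
    have "dist (s m) (s n) < r" if "N \<le> m" "N \<le> n" for m n
    proof -
      have "norm (s m - s n) \<le> norm (e N *\<^sub>R v)"
        using norm_mono_pos[OF abs_ge_zero s_diff[OF that]] by simp
      then show ?thesis
        using N e_pos[of N] by (simp add: dist_norm)
    qed
    then show "\<exists>M. \<forall>m\<ge>M. \<forall>n\<ge>M. dist (s m) (s n) < r"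
      by blast
  qed
  then obtain l where l: "s \<longlonglongrightarrow> l"
    using Cauchy_convergent convergentD by blast
  have "g c \<le> l" if "cmod c = 1" for c
  proof -
    have "(\<lambda>n. s n + e n *\<^sub>R v - g c) \<longlonglongrightarrow> l + 0 *\<^sub>R v - g c"
      by (intro tendsto_intros l e_lim)
    then have "0 \<le> l + 0 *\<^sub>R v - g c"
      by (rule nonneg_lim) (use g_le_s[OF that] in simp)
    then show ?thesis
      by simp
  qed
  moreover have "l \<le> u" if "\<And>c. cmod c = 1 \<Longrightarrow> g c \<le> u" for u
  proof -
    have "(\<lambda>n. u - s n) \<longlonglongrightarrow> u - l"
      by (intro tendsto_intros l)
    then have "0 \<le> u - l"
      by (rule nonneg_lim) (use s_least[OF that] in simp)
    then show ?thesis
      by simp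
  qed
  ultimately show ?thesis
    unfolding g_def by blast
qed

lemma
  fixes z :: "'a::banach_lattice complexification"
  shows modulus_upper: "cmod c = 1 \<Longrightarrow> re_part (scaleC c z) \<le> modulus z"
    and modulus_least: "(\<And>c. cmod c = 1 \<Longrightarrow> re_part (scaleC c z) \<le> u) \<Longrightarrow> modulus z \<le> u"
proof -
  let ?P = "\<lambda>s. (\<forall>c. cmod c = 1 \<longrightarrow> re_part (scaleC c z) \<le> s) \<and>
                (\<forall>u. (\<forall>c. cmod c = 1 \<longrightarrow> re_part (scaleC c z) \<le> u) \<longrightarrow> s \<le> u)"
  have "\<exists>!s. ?P s"
    using modulus_exists[of z] by (blast intro: order_antisym)
  then have P: "?P (modulus z)"
    unfolding modulus_def by (rule theI')
  show "cmod c = 1 \<Longrightarrow> re_part (scaleC c z) \<le> modulus z"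
    using P by blast
  show "(\<And>c. cmod c = 1 \<Longrightarrow> re_part (scaleC c z) \<le> u) \<Longrightarrow> modulus z \<le> u"
    using P by blast
qed

lemma abs_re_part_le: "\<bar>re_part z\<bar> \<le> modulus z"
  using modulus_upper[of 1 z] modulus_upper[of "- 1" z] by (intro abs_leI) simp_all

lemma abs_im_part_le: "\<bar>im_part z\<bar> \<le> modulus z"
  using modulus_upper[of "- \<i>" z] modulus_upper[of "\<i>" z] by (intro abs_leI) simp_all

lemma modulus_nonneg [simp]: "0 \<le> modulus z"
  using abs_re_part_le[of z] abs_ge_zero order_trans by blast

lemma modulus_le: "modulus z \<le> \<bar>re_part z\<bar> + \<bar>im_part z\<bar>"
proof (rule modulus_least)
  fix c :: complex
  assume c: "cmod c = 1"
  have part: "a *\<^sub>R x \<le> \<bar>x\<bar>" if "\<bar>a\<bar> \<le> 1" for a and x :: 'a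
  proof (cases "0 \<le> a")
    case True
    have "a *\<^sub>R x \<le> a *\<^sub>R \<bar>x\<bar>"
      by (rule scaleR_left_mono[OF abs_ge_self True])
    also have "\<dots> \<le> 1 *\<^sub>R \<bar>x\<bar>"
      by (rule scaleR_right_mono) (use that in auto)
    finally show ?thesis by simp
  next
    case False
    have "(- a) *\<^sub>R (- x) \<le> (- a) *\<^sub>R \<bar>x\<bar>"
      by (rule scaleR_left_mono[OF abs_ge_minus_self]) (use False in simp)
    also have "\<dots> \<le> 1 *\<^sub>R \<bar>x\<bar>"
      by (rule scaleR_right_mono) (use that in auto)
    finally show ?thesis
      by simp
  qed
  have "\<bar>Re c\<bar> \<le> 1" "\<bar>- Im c\<bar> \<le> 1"
    using c abs_Re_le_cmod[of c] abs_Im_le_cmod[of c] by simp_all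
  from add_mono[OF part[OF this(1), of "re_part z"] part[OF this(2), of "im_part z"]]
  show "re_part (scaleC c z) \<le> \<bar>re_part z\<bar> + \<bar>im_part z\<bar>"
    by simp
qed

lemma modulus_zero [simp]: "modulus 0 = 0"
  using modulus_le[of 0] by (intro antisym) simp_all

lemma modulus_add: "modulus (z + w) \<le> modulus z + modulus w"
proof (rule modulus_least)
  fix c :: complex
  assume "cmod c = 1"
  from add_mono[OF modulus_upper[OF this, of z] modulus_upper[OF this, of w]]
  show "re_part (scaleC c (z + w)) \<le> modulus z + modulus w"
    by (simp add: algebra_simps)
qed

lemma modulus_scaleC_le: "modulus (scaleC a z) \<le> cmod a *\<^sub>R modulus z"
proof (rule modulus_least)
  fix c :: complex
  assume c: "cmod c = 1"
  show "re_part (scaleC c (scaleC a z)) \<le> cmod a *\<^sub>R modulus z"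
  proof (cases "a = 0")
    case True
    then show ?thesis by simp
  next
    case False
    define d where "d = c * a / of_real (cmod a)"
    have d: "cmod d = 1" and ca: "c * a = of_real (cmod a) * d"
      using False c by (simp_all add: d_def norm_mult norm_divide)
    have "re_part (scaleC c (scaleC a z)) = cmod a *\<^sub>R re_part (scaleC d z)"
      by (simp add: scaleC_scaleC ca scaleR_diff_right)
    also have "\<dots> \<le> cmod a *\<^sub>R modulus z"
      by (rule scaleR_left_mono[OF modulus_upper[OF d]]) simp
    finally show ?thesis .
  qed
qed

lemma modulus_scaleC: "modulus (scaleC a z) = cmod a *\<^sub>R modulus z"
proof (cases "a = 0")
  case True
  have "scaleC 0 z = 0"
    by (simp add: complexification_eq_iff)
  then show ?thesis
    using True by simp
next
  case False
  have "z = scaleC (inverse a) (scaleC a z)"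
    using False by (simp add: scaleC_scaleC complexification_eq_iff del: inverse_complex.sel)
  then have "modulus z \<le> cmod (inverse a) *\<^sub>R modulus (scaleC a z)"
    by (metis modulus_scaleC_le)
  then have "cmod a *\<^sub>R modulus z \<le> cmod a *\<^sub>R cmod (inverse a) *\<^sub>R modulus (scaleC a z)"
    by (rule scaleR_left_mono) simp
  also have "\<dots> = modulus (scaleC a z)"
    using False by (simp add: norm_inverse)
  finally show ?thesis
    using modulus_scaleC_le[of a z] by (intro antisym)
qed

lemma modulus_Cplx_0: "modulus (Cplx x 0) = \<bar>x\<bar>"
  using abs_re_part_le[of "Cplx x 0"] modulus_le[of "Cplx x 0"] by (intro antisym) simp_all

text \<open>The modulus, regarded as an element of the positive cone of the complex lattice.\<close>

instantiation complexification :: (banach_lattice) abs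
begin

definition abs_complexification_def:
  "\<bar>z :: 'a complexification\<bar> = Cplx (modulus z) 0"

instance ..

end

instantiation complexification :: (banach_lattice) real_normed_vector
begin

definition norm_complexification_def:
  "norm (z :: 'a complexification) = norm (modulus z)"

definition sgn_complexification_def:
  "sgn (z :: 'a complexification) = z /\<^sub>R norm z"

definition dist_complexification_def:
  "dist (z :: 'a complexification) w = norm (z - w)"

definition uniformity_complexification_def [code del]:
  "uniformity = (INF e\<in>{0 <..}. principal {(z :: 'a complexification, w). dist z w < e})"

definition open_complexification_def [code del]:
  "open (U :: 'a complexification set) \<longleftrightarrow> (\<forall>z\<in>U. \<forall>\<^sub>F (z', w) in uniformity. z' = z \<longrightarrow> w \<in> U)"

instance
proof
  fix r :: real and z w :: "'a complexification" and U :: "'a complexification set"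
  have "z = 0" if "modulus z = 0"
    using abs_re_part_le[of z] abs_im_part_le[of z] that by (simp add: complexification_eq_iff)
  then show "norm z = 0 \<longleftrightarrow> z = 0"
    by (auto simp: norm_complexification_def)
  have "norm (modulus (z + w)) \<le> norm (modulus z + modulus w)"
    by (rule norm_mono_pos[OF modulus_nonneg modulus_add])
  also have "\<dots> \<le> norm (modulus z) + norm (modulus w)"
    by (rule norm_triangle_ineq)
  finally show "norm (z + w) \<le> norm z + norm w"
    by (simp add: norm_complexification_def)
  show "norm (r *\<^sub>R z) = \<bar>r\<bar> * norm z"
    using modulus_scaleC[of "of_real r" z]
    by (simp add: norm_complexification_def scaleC_of_real)
qed (simp_all add: sgn_complexification_def dist_complexification_def
       uniformity_complexification_def open_complexification_def)

end

lemma norm_scaleC: "norm (scaleC c z) = cmod c * norm z"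
  by (simp add: norm_complexification_def modulus_scaleC)

lemma norm_re_part_le: "norm (re_part z) \<le> norm z"
  using norm_mono_pos[OF abs_ge_zero abs_re_part_le[of z]]
  by (simp add: norm_complexification_def)

lemma norm_im_part_le: "norm (im_part z) \<le> norm z"
  using norm_mono_pos[OF abs_ge_zero abs_im_part_le[of z]]
  by (simp add: norm_complexification_def)

lemma norm_complexification_le: "norm z \<le> norm (re_part z) + norm (im_part z)"
proof -
  have "norm (modulus z) \<le> norm (\<bar>re_part z\<bar> + \<bar>im_part z\<bar>)"
    by (rule norm_mono_pos[OF modulus_nonneg modulus_le])
  also have "\<dots> \<le> norm (re_part z) + norm (im_part z)"
    using norm_triangle_ineq[of "\<bar>re_part z\<bar>" "\<bar>im_part z\<bar>"] by simp
  finally show ?thesis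
    by (simp add: norm_complexification_def)
qed

instance complexification :: (banach_lattice) banach
proof
  fix Z :: "nat \<Rightarrow> 'a complexification"
  assume "Cauchy Z"
  have "bounded_linear (re_part :: 'a complexification \<Rightarrow> 'a)"
    by (rule bounded_linear_intro[of _ 1]) (simp_all add: norm_re_part_le)
  from bounded_linear.Cauchy[OF this \<open>Cauchy Z\<close>] obtain x where x: "(\<lambda>n. re_part (Z n)) \<longlonglongrightarrow> x"
    using Cauchy_convergent convergentD by blast
  have "bounded_linear (im_part :: 'a complexification \<Rightarrow> 'a)"
    by (rule bounded_linear_intro[of _ 1]) (simp_all add: norm_im_part_le)
  from bounded_linear.Cauchy[OF this \<open>Cauchy Z\<close>] obtain y where y: "(\<lambda>n. im_part (Z n)) \<longlonglongrightarrow> y"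
    using Cauchy_convergent convergentD by blast
  have "(\<lambda>n. norm (re_part (Z n) - x) + norm (im_part (Z n) - y)) \<longlonglongrightarrow> 0"
    using tendsto_add[OF tendsto_norm_zero[OF LIM_zero[OF x]] tendsto_norm_zero[OF LIM_zero[OF y]]]
    by simp
  then have "(\<lambda>n. Z n - Cplx x y) \<longlonglongrightarrow> 0"
  proof (rule Lim_null_comparison[rotated])
    show "\<forall>\<^sub>F n in sequentially.
        norm (Z n - Cplx x y) \<le> norm (re_part (Z n) - x) + norm (im_part (Z n) - y)"
      using norm_complexification_le[of "Z _ - Cplx x y"] by (intro always_eventually) simp
  qed
  then have "Z \<longlonglongrightarrow> Cplx x y"
    by (rule LIM_zero_cancel)
  then show "convergent Z"
    by (rule convergentI)
qed


section \<open>Semigroups, ideals and functionals\<close>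

text \<open>
  The scalar multiplication is a parameter of the following notions, so that they apply both to
  real Banach lattices (with \<^const>\<open>scaleR\<close>) and to complex ones (with \<^const>\<open>scaleC\<close>).
\<close>

definition bounded_operator ::
    "('k::real_normed_field \<Rightarrow> 'e \<Rightarrow> 'e) \<Rightarrow> ('k \<Rightarrow> 'f \<Rightarrow> 'f) \<Rightarrow>
     ('e::real_normed_vector \<Rightarrow> 'f::real_normed_vector) \<Rightarrow> bool" where
  "bounded_operator smul1 smul2 f \<longleftrightarrow>
     Vector_Spaces.linear smul1 smul2 f \<and> (\<exists>K. \<forall>x. norm (f x) \<le> K * norm x)"

text \<open>\<open>T t\<close> stands for \<open>e\<^sup>t\<^sup>A\<close>; its values at negative \<open>t\<close> are irrelevant.\<close>

definition C0_semigroup ::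
    "('k::real_normed_field \<Rightarrow> 'e \<Rightarrow> 'e) \<Rightarrow> (real \<Rightarrow> 'e \<Rightarrow> 'e::real_normed_vector) \<Rightarrow> bool" where
  "C0_semigroup smul T \<longleftrightarrow>
     (\<forall>t\<ge>0. bounded_operator smul smul (T t)) \<and>
     T 0 = id \<and>
     (\<forall>s\<ge>0. \<forall>t\<ge>0. T (s + t) = T s \<circ> T t) \<and>
     (\<forall>f. ((\<lambda>t. T t f) \<longlongrightarrow> f) (at_right 0))"

definition positive_semigroup :: "(real \<Rightarrow> 'e \<Rightarrow> 'e::{zero, ord}) \<Rightarrow> bool" where
  "positive_semigroup T \<longleftrightarrow> (\<forall>t\<ge>0. \<forall>f\<ge>0. 0 \<le> T t f)"

definition closed_ideal ::
    "('k::real_normed_field \<Rightarrow> 'e \<Rightarrow> 'e) \<Rightarrow> 'e::{real_normed_vector, ord, abs} set \<Rightarrow> bool" where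
  "closed_ideal smul I \<longleftrightarrow>
     closed I \<and> module.subspace smul I \<and> (\<forall>f g. \<bar>f\<bar> \<le> \<bar>g\<bar> \<and> g \<in> I \<longrightarrow> f \<in> I)"

definition irreducible_semigroup ::
    "('k::real_normed_field \<Rightarrow> 'e \<Rightarrow> 'e) \<Rightarrow>
     (real \<Rightarrow> 'e \<Rightarrow> 'e::{real_normed_vector, ord, abs}) \<Rightarrow> bool" where
  "irreducible_semigroup smul T \<longleftrightarrow>
     \<not> (\<exists>I. closed_ideal smul I \<and> I \<noteq> {0} \<and> I \<noteq> UNIV \<and> (\<forall>t\<ge>0. T t ` I \<subseteq> I))"

definition uniformly_eventually_invariant :: "(real \<Rightarrow> 'e \<Rightarrow> 'e) \<Rightarrow> 'e set \<Rightarrow> bool" where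
  "uniformly_eventually_invariant T I \<longleftrightarrow> (\<exists>t0\<ge>0. \<forall>t\<ge>t0. T t ` I \<subseteq> I)"

definition persistently_irreducible ::
    "('k::real_normed_field \<Rightarrow> 'e \<Rightarrow> 'e) \<Rightarrow>
     (real \<Rightarrow> 'e \<Rightarrow> 'e::{real_normed_vector, ord, abs}) \<Rightarrow> bool" where
  "persistently_irreducible smul T \<longleftrightarrow>
     \<not> (\<exists>I. closed_ideal smul I \<and> I \<noteq> {0} \<and> I \<noteq> UNIV \<and> uniformly_eventually_invariant T I)"

text \<open>The positive cone of the dual; \<open>\<real>\<^sub>\<ge>\<^sub>0\<close> is taken in the scalar field.\<close>

definition positive_dual ::
    "('k::real_normed_field \<Rightarrow> 'e \<Rightarrow> 'e) \<Rightarrow> ('e::{real_normed_vector, ord} \<Rightarrow> 'k) set" where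
  "positive_dual smul =
     {\<phi>. bounded_operator smul (*) \<phi> \<and> (\<forall>f\<ge>0. \<phi> f \<in> \<real>\<^sub>\<ge>\<^sub>0)}"

end

theory Submission
  imports Defs
begin

text \<open>
  If \<open>f > 0\<close> and \<open>\<phi> > 0\<close> satisfy \<open>\<langle>\<phi>, T t f\<rangle> = 0\<close> for all \<open>t \<ge> 0\<close>, then \<open>{g. \<forall>t\<ge>0. \<langle>\<phi>, T t |g|\<rangle> = 0}\<close> is
  a nontrivial invariant closed ideal; so (i) implies (ii). An irreducible positive semigroup maps no
  \<open>f > 0\<close> to \<open>0\<close>: otherwise the invariant closed ideal \<open>{g. T s |g| = 0}\<close> is everything for some \<open>s > 0\<close>,
  and then, halving repeatedly, for arbitrarily small \<open>s\<close>. Hence (v) is (ii) applied to \<open>T t0 f > 0\<close>.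
  Conversely, a proper closed ideal \<open>I\<close> is annihilated by a nonzero positive functional, obtained by
  Hahn--Banach from the sublinear functional \<open>x \<mapsto> inf {\<parallel>(x - g)\<^sup>+\<parallel> : g \<in> I}\<close>; this yields (iii) from (v)
  and (i) from (ii). In the complex case everything is determined by the real part of \<open>E\<close>: positive
  operators and functionals and closed ideals are complexifications of real ones.
\<close>

section \<open>Sublinear functionals\<close>

text \<open>Homogeneity is required only as an inequality, a form that passes to infima directly;
  equality follows from it.\<close>

definition sublinear :: "('a::real_vector \<Rightarrow> real) \<Rightarrow> bool" where
  "sublinear q \<longleftrightarrow> (\<forall>x y. q (x + y) \<le> q x + q y) \<and> (\<forall>c\<ge>0. \<forall>x. q (c *\<^sub>R x) \<le> c * q x)"

lemma sublinear_add: "sublinear q \<Longrightarrow> q (x + y) \<le> q x + q y"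
  by (simp add: sublinear_def)

text \<open>For c > 0 the defining inequality with factor \<open>inverse c\<close>, applied to
  \<open>c *\<^sub>R x\<close>, gives the reverse estimate; at c = 0 subadditivity supplies the
  missing bound 0 \<le> q 0.\<close>

lemma sublinear_scaleR:
  assumes "sublinear q" "0 \<le> c"
  shows "q (c *\<^sub>R x) = c * q x"
proof (cases "c = 0")
  case True
  have "q 0 \<le> 0"
    using assms(1) unfolding sublinear_def by (metis mult_zero_left order_refl scaleR_zero_left)
  moreover have "q 0 \<le> q 0 + q 0"
    using sublinear_add[OF assms(1), of 0 0] by simp
  ultimately show ?thesis
    using True by simp
next
  case False
  then have c: "0 < c"
    using assms(2) by simp
  have "q (inverse c *\<^sub>R c *\<^sub>R x) \<le> inverse c * q (c *\<^sub>R x)"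
    using assms(1) c unfolding sublinear_def by (metis inverse_nonnegative_iff_nonnegative less_imp_le)
  then have "c * q x \<le> q (c *\<^sub>R x)"
    using c by (simp add: field_simps)
  then show ?thesis
    using assms unfolding sublinear_def by (auto intro: antisym)
qed

lemma sublinear_zero: "sublinear q \<Longrightarrow> q 0 = 0"
  using sublinear_scaleR[of q 0 0] by simp

lemma sublinear_minus: "sublinear q \<Longrightarrow> - q (- x) \<le> q x"
  using sublinear_add[of q x "- x"] by (simp add: sublinear_zero)

text \<open>Common tool for three infima: along a ray, over a chain, over an ideal. The index k may
  depend on the vectors, so each application only has to name a suitable competitor.\<close>

lemma sublinear_INF:
  assumes ne: "J \<noteq> {}"
    and bdd: "\<And>x. bdd_below ((\<lambda>j. F j x) ` J)"
    and add: "\<And>i j x y. i \<in> J \<Longrightarrow> j \<in> J \<Longrightarrow> \<exists>k\<in>J. F k (x + y) \<le> F i x + F j y"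
    and scale: "\<And>i c x. i \<in> J \<Longrightarrow> 0 \<le> c \<Longrightarrow> \<exists>k\<in>J. F k (c *\<^sub>R x) \<le> c * F i x"
  shows "sublinear (\<lambda>x. INF j\<in>J. F j x)"
proof -
  define q where "q x = (INF j\<in>J. F j x)" for x
  have q_le: "q x \<le> F j x" if "j \<in> J" for j x
    unfolding q_def by (rule cINF_lower[OF bdd that])
  have q_ge: "r \<le> q x" if "\<And>j. j \<in> J \<Longrightarrow> r \<le> F j x" for r x
    unfolding q_def by (rule cINF_greatest[OF ne that])
  have "q (x + y) \<le> q x + q y" for x y
  proof -
    have le: "q (x + y) \<le> F i x + F j y" if "i \<in> J" "j \<in> J" for i j
      using add[OF that, of x y] q_le order_trans by blast
    \<comment> \<open>The two infima are taken one after the other: first over j with i fixed, then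
      over i.\<close>
    have "q (x + y) - F i x \<le> q y" if "i \<in> J" for i
      by (rule q_ge) (use le[OF that] in \<open>simp add: algebra_simps\<close>)
    then have "q (x + y) - q y \<le> q x"
      by (intro q_ge) (simp add: algebra_simps)
    then show ?thesis
      by simp
  qed
  moreover have "q (c *\<^sub>R x) \<le> c * q x" if c: "0 \<le> c" for c x
  proof -
    have le: "q (c *\<^sub>R x) \<le> c * F i x" if "i \<in> J" for i
      using scale[OF that c, of x] q_le order_trans by blast
    show ?thesis
    proof (cases "c = 0")
      case True
      then show ?thesis
        using ne le by auto
    next
      case False
      then have "q (c *\<^sub>R x) / c \<le> q x"
        using c le by (intro q_ge) (simp add: field_simps)
      then show ?thesis
        using False c by (simp add: field_simps)
    qed
  qed
  ultimately show ?thesis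
    by (simp add: sublinear_def flip: q_def)
qed

text \<open>For a minimal \<open>q\<close> the functional \<open>r\<close> is \<open>q\<close> itself, which makes \<open>q\<close> superadditive.\<close>

lemma sublinear_directional:
  fixes q :: "'a::real_vector \<Rightarrow> real"
  assumes q: "sublinear q"
  obtains r where "sublinear r" "r \<le> q" "\<And>x. r x \<le> q (x + y) - q y"
proof -
  \<comment> \<open>The functional r is the infimum of F over t \<ge> 0: t = 0 gives r \<le> q, and
    t = 1 gives the bound by q (x + y) - q y.\<close>
  define F where "F t x = q (x + t *\<^sub>R y) - t * q y" for t x
  have lower: "- q (- x) \<le> F t x" if "0 \<le> t" for t x
    using sublinear_add[OF q, of "x + t *\<^sub>R y" "- x"] sublinear_scaleR[OF q that, of y]
    by (simp add: F_def)
  have bdd: "bdd_below ((\<lambda>t. F t x) ` {0..})" for x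
    by (rule bdd_belowI2[of _ "- q (- x)"]) (simp add: lower)
  have "sublinear (\<lambda>x. INF t\<in>{0..}. F t x)"
  proof (rule sublinear_INF[OF _ bdd])
    fix s t :: real and x z :: 'a
    assume "s \<in> {0..}" "t \<in> {0..}"
    moreover have "F (s + t) (x + z) \<le> F s x + F t z"
      using sublinear_add[OF q, of "x + s *\<^sub>R y" "z + t *\<^sub>R y"] by (simp add: F_def algebra_simps)
    ultimately show "\<exists>k\<in>{0..}. F k (x + z) \<le> F s x + F t z"
      by (intro bexI[of _ "s + t"]) auto
  next
    fix s c :: real and x :: 'a
    assume "s \<in> {0..}" "0 \<le> c"
    moreover from this have "F (c * s) (c *\<^sub>R x) \<le> c * F s x"
      using sublinear_scaleR[OF q, of c "x + s *\<^sub>R y"] by (simp add: F_def algebra_simps)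
    ultimately show "\<exists>k\<in>{0..}. F k (c *\<^sub>R x) \<le> c * F s x"
      by (intro bexI[of _ "c * s"]) auto
  qed simp
  moreover have "(\<lambda>x. INF t\<in>{0..}. F t x) \<le> q"
  proof (rule le_funI)
    fix x
    show "(INF t\<in>{0..}. F t x) \<le> q x"
      using cINF_lower[OF bdd, of 0 x] by (simp add: F_def)
  qed
  moreover have "(INF t\<in>{0..}. F t x) \<le> q (x + y) - q y" for x
    using cINF_lower[OF bdd, of 1 x] by (simp add: F_def)
  ultimately show thesis
    by (rule that)
qed

text \<open>Zorn's lemma for the reversed pointwise order. A nonempty chain has its pointwise
  infimum as lower bound, finite because every sublinear q \<le> p satisfies - p (- x) \<le> - q (-
  x) \<le> q x.\<close>

lemma sublinear_minimal:
  fixes p :: "'a::real_vector \<Rightarrow> real"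
  assumes p: "sublinear p"
  obtains m where "sublinear m" "m \<le> p" "\<And>q. sublinear q \<Longrightarrow> q \<le> m \<Longrightarrow> q = m"
proof -
  define A where "A = {q. sublinear q \<and> q \<le> p}"
  have "\<exists>m\<in>A. \<forall>q\<in>A. q \<le> m \<longrightarrow> q = m"
  proof (rule predicate_Zorn[of A "\<lambda>q r. r \<le> q"])
    show "partial_order_on A (relation_of (\<lambda>q r. r \<le> q) A)"
      by (rule partial_order_on_relation_ofI) auto
  next
    fix C
    assume "C \<in> Chains (relation_of (\<lambda>q r. r \<le> q) A)"
    then have CA: "q \<in> A" if "q \<in> C" for q
      using that by (auto simp: Chains_def relation_of_def)
    have chain: "q \<le> r \<or> r \<le> q" if "q \<in> C" "r \<in> C" for q r
      using that \<open>C \<in> _\<close> by (auto simp: Chains_def relation_of_def)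
    show "\<exists>u\<in>A. \<forall>q\<in>C. u \<le> q"
    proof (cases "C = {}")
      case True
      then show ?thesis
        using p by (auto simp: A_def)
    next
      case False
      have sub: "sublinear q" "q \<le> p" if "q \<in> C" for q
        using CA[OF that] by (simp_all add: A_def)
      have "- p (- x) \<le> q x" if "q \<in> C" for q x
        using le_funD[OF sub(2)[OF that], of "- x"] sublinear_minus[OF sub(1)[OF that], of x] by simp
      then have bdd: "bdd_below ((\<lambda>q. q x) ` C)" for x
        by (intro bdd_belowI2)
      define u where "u x = (INF q\<in>C. q x)" for x
      have u_le: "u \<le> q" if "q \<in> C" for q
        unfolding u_def by (rule le_funI) (rule cINF_lower[OF bdd that])
      have "sublinear u"
        unfolding u_def
      proof (rule sublinear_INF[OF False bdd])
        fix q r x y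
        assume qr: "q \<in> C" "r \<in> C"
        \<comment> \<open>The smaller of the two chain members serves as k.\<close>
        from chain[OF this] show "\<exists>k\<in>C. k (x + y) \<le> q x + r y"
        proof
          assume "q \<le> r"
          then have "q y \<le> r y"
            by (rule le_funD)
          then show ?thesis
            using sublinear_add[OF sub(1)[OF qr(1)], of x y] by (intro bexI[OF _ qr(1)]) simp
        next
          assume "r \<le> q"
          then have "r x \<le> q x"
            by (rule le_funD)
          then show ?thesis
            using sublinear_add[OF sub(1)[OF qr(2)], of x y] by (intro bexI[OF _ qr(2)]) simp
        qed
      next
        fix q x and c :: real
        assume "q \<in> C" "0 \<le> c"
        then show "\<exists>k\<in>C. k (c *\<^sub>R x) \<le> c * q x"
          using sublinear_scaleR[OF sub(1)] by (intro bexI[of _ q]) auto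
      qed
      moreover obtain q where "q \<in> C"
        using False by blast
      ultimately have "u \<in> A"
        using u_le[of q] sub(2)[of q] by (simp add: A_def)
      then show ?thesis
        using u_le by blast
    qed
  qed
  then obtain m where m: "m \<in> A" and min: "\<And>q. q \<in> A \<Longrightarrow> q \<le> m \<Longrightarrow> q = m"
    by blast
  show thesis
  proof (rule that)
    show "sublinear m" "m \<le> p"
      using m by (simp_all add: A_def)
    then show "q = m" if "sublinear q" "q \<le> m" for q
      using that order_trans by (intro min) (auto simp: A_def)
  qed
qed

text \<open>A minimal sublinear functional is linear. Minimising below the directional functional r,
  rather than below p itself, forces equality at y.\<close>

theorem Hahn_Banach_sublinear:
  fixes p :: "'a::real_vector \<Rightarrow> real"
  assumes p: "sublinear p"
  obtains \<phi> where "linear \<phi>" "\<And>x. \<phi> x \<le> p x" "\<phi> y = p y"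
proof -
  obtain r where r: "sublinear r" "r \<le> p" and r_y: "\<And>x. r x \<le> p (x + y) - p y"
    using sublinear_directional[OF p] by metis
  obtain m where m: "sublinear m" "m \<le> r" and min: "\<And>q. sublinear q \<Longrightarrow> q \<le> m \<Longrightarrow> q = m"
    using sublinear_minimal[OF r(1)] by metis
  \<comment> \<open>Minimality identifies the directional functional q in direction z with m, so its
    bound reads m x + m z \<le> m (x + z).\<close>
  have add: "m (x + z) = m x + m z" for x z
  proof -
    obtain q where "sublinear q" "q \<le> m" and q: "\<And>x. q x \<le> m (x + z) - m z"
      using sublinear_directional[OF m(1)] by metis
    then have "m x \<le> m (x + z) - m z"
      using min[of q] q[of x] by simp
    then show ?thesis
      using sublinear_add[OF m(1), of x z] by simp
  qed
  have minus: "m (- x) = - m x" for x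
    using add[of x "- x"] sublinear_zero[OF m(1)] by simp
  have "m (c *\<^sub>R x) = c * m x" for c x
  proof (cases "0 \<le> c")
    case False
    then show ?thesis
      using sublinear_scaleR[OF m(1), of "- c" x] minus[of "c *\<^sub>R x"] by simp
  qed (rule sublinear_scaleR[OF m(1)])
  then have "linear m"
    by (intro linearI) (simp_all add: add)
  moreover have le: "m x \<le> p x" for x
    using le_funD[OF m(2), of x] le_funD[OF r(2), of x] by simp
  \<comment> \<open>Here r (- y) \<le> p 0 - p y, and p 0 = 0.\<close>
  moreover have "m (- y) \<le> - p y"
    using le_funD[OF m(2), of "- y"] r_y[of "- y"] sublinear_zero[OF p] by simp
  then have "m y = p y"
    using le[of y] minus[of y] by simp
  ultimately show thesis
    by (rule that)
qed

section \<open>Closed ideals of real Banach lattices\<close>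

lemma linear_scaleR_iff: "Vector_Spaces.linear scaleR scaleR f \<longleftrightarrow> linear f"
  by (simp add: linear_def)

lemma bounded_operator_scaleR_iff: "bounded_operator scaleR scaleR f \<longleftrightarrow> bounded_linear f"
proof
  assume "bounded_operator scaleR scaleR f"
  then obtain K where "linear f" "\<And>x. norm (f x) \<le> K * norm x"
    by (auto simp: bounded_operator_def linear_scaleR_iff)
  then show "bounded_linear f"
    by (intro bounded_linear_intro[of f K]) (simp_all add: linear_add linear_scale mult.commute)
next
  assume f: "bounded_linear f"
  then show "bounded_operator scaleR scaleR f"
    using bounded_linear.bounded[OF f]
    by (auto simp: bounded_operator_def linear_scaleR_iff bounded_linear.linear mult.commute)
qed

lemma positive_dual_scaleR_iff:
  "\<phi> \<in> positive_dual scaleR \<longleftrightarrow> bounded_linear \<phi> \<and> (\<forall>f\<ge>0. 0 \<le> \<phi> f)"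
proof -
  have "bounded_operator scaleR (*) \<phi> \<longleftrightarrow> bounded_operator scaleR scaleR \<phi>"
    by (simp add: scaleR_conv_of_real[abs_def])
  moreover have "r \<in> \<real>\<^sub>\<ge>\<^sub>0 \<longleftrightarrow> 0 \<le> r" for r :: real
    using nonneg_Reals_of_real_iff[of r, where ?'a = real] by simp
  ultimately show ?thesis
    by (simp add: positive_dual_def bounded_operator_scaleR_iff)
qed

lemma subspace_scaleR_iff: "module.subspace scaleR I \<longleftrightarrow> subspace I"
  by (simp add: subspace_raw_def)

lemma abs_add_self_nonneg: "0 \<le> \<bar>x\<bar> + x" for x :: "'a::banach_lattice"
  using add_right_mono[OF abs_ge_minus_self[of x], of x] by simp

lemma abs_scaleR_lattice_le: "\<bar>c *\<^sub>R x\<bar> \<le> \<bar>c\<bar> *\<^sub>R \<bar>x\<bar>" for x :: "'a::banach_lattice"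
proof -
  have *: "\<bar>c *\<^sub>R x\<bar> \<le> c *\<^sub>R \<bar>x\<bar>" if "0 \<le> c" for c
    using scaleR_left_mono[OF abs_ge_self[of x] that] scaleR_left_mono[OF abs_ge_minus_self[of x] that]
    by (intro abs_leI) simp_all
  show ?thesis
    using *[of c] *[of "- c"] by (cases "0 \<le> c") simp_all
qed

section \<open>Closed ideals and functionals annihilating them\<close>

lemma closed_idealD:
  fixes I :: "'a::banach_lattice set"
  assumes "closed_ideal scaleR I"
  shows "closed I" "subspace I" "\<And>f g. \<bar>f\<bar> \<le> \<bar>g\<bar> \<Longrightarrow> g \<in> I \<Longrightarrow> f \<in> I"
  using assms unfolding closed_ideal_def subspace_scaleR_iff by blast+

lemma closed_ideal_abs_iff:
  fixes I :: "'a::banach_lattice set"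
  assumes "closed_ideal scaleR I"
  shows "\<bar>x\<bar> \<in> I \<longleftrightarrow> x \<in> I"
  using closed_idealD(3)[OF assms, of x "\<bar>x\<bar>"] closed_idealD(3)[OF assms, of "\<bar>x\<bar>" x] by auto

lemma closed_ideal_positive_element:
  fixes I :: "'a::banach_lattice set"
  assumes "closed_ideal scaleR I" "I \<noteq> {0}"
  obtains f where "0 < f" "f \<in> I"
proof -
  obtain x where "x \<in> I" "x \<noteq> 0"
    using assms(2) closed_idealD(2)[OF assms(1)] subspace_0 by blast
  then show thesis
    using closed_ideal_abs_iff[OF assms(1), of x] that[of "\<bar>x\<bar>"] by simp
qed

text \<open>A linear \<phi> \<le> p with \<phi> x = p x works: p \<le> 0 on I makes \<phi> vanish
  there, p (- z) \<le> 0 for z \<ge> 0 makes it positive, p is bounded by the norm, and p x > 0 for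
  a suitable x \<ge> 0 outside I makes \<phi> nonzero.\<close>

lemma closed_ideal_separation:
  fixes I :: "'a::banach_lattice set"
  assumes I: "closed_ideal scaleR I" and "I \<noteq> UNIV"
  obtains \<phi> where "\<phi> \<in> positive_dual scaleR" "\<phi> \<noteq> (\<lambda>_. 0)" "\<And>g. g \<in> I \<Longrightarrow> \<phi> g = 0"
proof -
  note sub = closed_idealD(2)[OF I]
  have "\<exists>x. x \<notin> I"
    using assms(2) by blast
  \<comment> \<open>The modulus of a vector outside I also lies outside I, so x can be chosen
    nonnegative.\<close>
  then obtain x where x: "0 \<le> x" "x \<notin> I"
    using closed_ideal_abs_iff[OF I] abs_ge_zero by blast
  obtain e where e: "0 < e" "ball x e \<subseteq> - I"
    using closed_idealD(1)[OF I] x(2) open_contains_ball[of "- I"] by (auto simp: open_Compl)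
  \<comment> \<open>N is the norm of the positive part, and p is the distance to I measured by it.
    The asymmetry of N is what encodes positivity.\<close>
  define N where "N z = norm (sup z 0)" for z :: 'a
  define p where "p z = (INF g\<in>I. N (z - g))" for z
  have bdd: "bdd_below ((\<lambda>g. N (z - g)) ` I)" for z
    by (rule bdd_belowI2[of _ 0]) (simp add: N_def)
  have ne: "I \<noteq> {}"
    using subspace_0[OF sub] by blast
  have p_le: "p z \<le> N (z - g)" if "g \<in> I" for g z
    unfolding p_def by (rule cINF_lower[OF bdd that])
  have "sublinear p"
    unfolding p_def
  proof (rule sublinear_INF[OF ne bdd])
    fix g h z w
    assume gh: "g \<in> I" "h \<in> I"
    have "sup (z + w - (g + h)) 0 \<le> sup (z - g) 0 + sup (w - h) 0"
      using add_mono[OF sup_ge1[of "z - g" 0] sup_ge1[of "w - h" 0]]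
      by (intro sup_least) (simp_all add: algebra_simps)
    then have "N (z + w - (g + h)) \<le> norm (sup (z - g) 0 + sup (w - h) 0)"
      unfolding N_def by (intro norm_mono_pos) simp_all
    also have "\<dots> \<le> N (z - g) + N (w - h)"
      unfolding N_def by (rule norm_triangle_ineq)
    finally show "\<exists>k\<in>I. N (z + w - k) \<le> N (z - g) + N (w - h)"
      using subspace_add[OF sub gh] by blast
  next
    fix g z and c :: real
    assume g: "g \<in> I" and c: "0 \<le> c"
    have "sup (c *\<^sub>R z - c *\<^sub>R g) 0 \<le> c *\<^sub>R sup (z - g) 0"
      using scaleR_left_mono[OF sup_ge1[of "z - g" 0] c] c
      by (intro sup_least) (simp_all add: algebra_simps scaleR_nonneg_nonneg)
    then have "N (c *\<^sub>R z - c *\<^sub>R g) \<le> norm (c *\<^sub>R sup (z - g) 0)"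
      unfolding N_def by (intro norm_mono_pos) simp_all
    then show "\<exists>k\<in>I. N (c *\<^sub>R z - k) \<le> c * N (z - g)"
      using subspace_scale[OF sub g, of c] c by (auto simp: N_def)
  qed
  then obtain \<phi> where lin: "linear \<phi>" and le: "\<And>z. \<phi> z \<le> p z" and \<phi>x: "\<phi> x = p x"
    using Hahn_Banach_sublinear by metis
  have le_N: "\<phi> z \<le> N z" for z
    using le[of z] p_le[OF subspace_0[OF sub], of z] by simp
  \<comment> \<open>The infimum of g and x lies between -|g| and |g|, hence in I, and x minus this
    infimum is the positive part of x - g. So N (x - g) is the norm distance from x to a point of I,
    which is at least e.\<close>
  have "e \<le> N (x - g)" if g: "g \<in> I" for g
  proof -
    have "- \<bar>g\<bar> \<le> g" "- \<bar>g\<bar> \<le> x"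
      using abs_ge_minus_self[of g] x(1) by (simp_all add: minus_le_iff order_trans[of _ 0])
    then have "- \<bar>g\<bar> \<le> inf g x"
      by simp
    then have "\<bar>inf g x\<bar> \<le> \<bar>g\<bar>"
      using abs_ge_self[of g] by (intro abs_leI) (auto simp: minus_le_iff intro: le_infI1)
    then have "inf g x \<in> I"
      using closed_idealD(3)[OF I _ g] by blast
    then have "inf g x \<notin> ball x e"
      using e(2) by blast
    moreover have "x - inf g x = sup (x - g) 0"
      by (simp add: diff_inf_eq_sup add_sup_distrib_left)
    ultimately show ?thesis
      by (simp add: N_def dist_norm)
  qed
  then have "e \<le> p x"
    unfolding p_def by (intro cINF_greatest[OF ne])
  then have "\<phi> x \<noteq> 0"
    using \<phi>x e(1) by simp
  moreover have le_norm: "\<phi> z \<le> norm z" for z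
    using le_N[of z] norm_mono[of "sup z 0" z] by (simp add: N_def abs_ge_self)
  have "\<bar>\<phi> z\<bar> \<le> norm z" for z
    using le_norm[of z] le_norm[of "- z"] linear_neg[OF lin, of z] by (intro abs_leI) simp_all
  then have "bounded_linear \<phi>"
    using lin by (intro bounded_linear_intro[of \<phi> 1]) (simp_all add: linear_add linear_scale)
  moreover have "0 \<le> \<phi> z" if "0 \<le> z" for z
    using le_N[of "- z"] linear_neg[OF lin, of z] that by (simp add: N_def sup_absorb2)
  moreover have "\<phi> g = 0" if "g \<in> I" for g
  proof -
    have "\<phi> h \<le> 0" if "h \<in> I" for h
      using le[of h] p_le[OF that, of h] by (simp add: N_def)
    from this[of g] this[of "- g"] show ?thesis
      using that subspace_neg[OF sub that] linear_neg[OF lin, of g] by simp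
  qed
  ultimately show thesis
    by (intro that[of \<phi>]) (auto simp: positive_dual_scaleR_iff)
qed

section \<open>Null ideals of positive operators\<close>

definition null_ideal :: "('a::banach_lattice \<Rightarrow> 'c::banach_lattice) set \<Rightarrow> 'a set" where
  "null_ideal X = {g. \<forall>P\<in>X. P \<bar>g\<bar> = 0}"

lemma null_idealD: "g \<in> null_ideal X \<Longrightarrow> P \<in> X \<Longrightarrow> P \<bar>g\<bar> = 0"
  by (simp add: null_ideal_def)

text \<open>Positivity gives 0 \<le> P f \<le> P g for 0 \<le> f \<le> g, whence solidity and the
  subspace property; closedness comes from continuity of the modulus. Admitting a set of operators
  covers both a single T s and all functionals f \<mapsto> \<phi> (T t f).\<close>

lemma closed_ideal_null_ideal:
  fixes X :: "('a::banach_lattice \<Rightarrow> 'c::banach_lattice) set"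
  assumes lin: "\<And>P. P \<in> X \<Longrightarrow> bounded_linear P"
    and pos: "\<And>P f. P \<in> X \<Longrightarrow> 0 \<le> f \<Longrightarrow> 0 \<le> P f"
  shows "closed_ideal scaleR (null_ideal X)"
proof -
  have dominated: "P f = 0" if P: "P \<in> X" and "0 \<le> f" "f \<le> g" "P g = 0" for P f g
  proof -
    have "P g - P f = P (g - f)"
      by (simp add: bounded_linear.linear[OF lin[OF P]] linear_diff)
    then have "P f \<le> P g"
      using pos[OF P, of "g - f"] that(3) by (metis diff_ge_0_iff_ge)
    then have "P f \<le> 0"
      using that(4) by simp
    then show ?thesis
      using pos[OF P \<open>0 \<le> f\<close>] by (rule antisym)
  qed
  have "closed (null_ideal X)"
    unfolding closed_sequential_limits
  proof (intro allI impI)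
    fix g l
    assume gl: "(\<forall>n. g n \<in> null_ideal X) \<and> g \<longlonglongrightarrow> l"
    have "(\<lambda>n. \<bar>g n\<bar> - \<bar>l\<bar>) \<longlonglongrightarrow> 0"
    proof (rule Lim_null_comparison)
      show "\<forall>\<^sub>F n in sequentially. norm (\<bar>g n\<bar> - \<bar>l\<bar>) \<le> norm (g n - l)"
        by (intro always_eventually allI norm_mono abs_triangle_ineq3)
      show "(\<lambda>n. norm (g n - l)) \<longlonglongrightarrow> 0"
        using gl by (simp add: LIM_zero tendsto_norm_zero)
    qed
    then have lim: "(\<lambda>n. \<bar>g n\<bar>) \<longlonglongrightarrow> \<bar>l\<bar>"
      by (rule LIM_zero_cancel)
    have "P \<bar>l\<bar> = 0" if P: "P \<in> X" for P
    proof -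
      have "(\<lambda>n. P \<bar>g n\<bar>) \<longlonglongrightarrow> P \<bar>l\<bar>"
        using bounded_linear.tendsto[OF lin[OF P] lim] .
      moreover have "P \<bar>g n\<bar> = 0" for n
        using gl P by (simp add: null_ideal_def)
      ultimately show ?thesis
        by (simp add: LIMSEQ_const_iff)
    qed
    then show "l \<in> null_ideal X"
      by (simp add: null_ideal_def)
  qed
  moreover have "subspace (null_ideal X)"
  proof (rule subspaceI)
    show "0 \<in> null_ideal X"
      using lin by (auto simp: null_ideal_def bounded_linear.linear linear_0)
  next
    fix x y
    assume "x \<in> null_ideal X" "y \<in> null_ideal X"
    then have null: "P \<bar>x\<bar> = 0" "P \<bar>y\<bar> = 0" if "P \<in> X" for P
      using that by (simp_all add: null_ideal_def)
    have "P (\<bar>x\<bar> + \<bar>y\<bar>) = 0" if "P \<in> X" for P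
      by (simp add: linear_add[OF bounded_linear.linear[OF lin[OF that]]] null[OF that])
    then show "x + y \<in> null_ideal X"
      using dominated[OF _ abs_ge_zero abs_triangle_ineq[of x y]] by (simp add: null_ideal_def)
  next
    fix x and c :: real
    assume "x \<in> null_ideal X"
    then have "P (\<bar>c\<bar> *\<^sub>R \<bar>x\<bar>) = 0" if "P \<in> X" for P
      using that by (simp add: null_ideal_def bounded_linear.linear[OF lin] linear_scale)
    then show "c *\<^sub>R x \<in> null_ideal X"
      using dominated[OF _ abs_ge_zero abs_scaleR_lattice_le[of c x]] by (simp add: null_ideal_def)
  qed
  moreover have "f \<in> null_ideal X" if "\<bar>f\<bar> \<le> \<bar>g\<bar>" "g \<in> null_ideal X" for f g
    using dominated[OF _ abs_ge_zero that(1)] that(2) by (simp add: null_ideal_def)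
  ultimately show ?thesis
    unfolding closed_ideal_def subspace_scaleR_iff by blast
qed

section \<open>Positive semigroups on real Banach lattices\<close>

text \<open>The time set is a parameter: \<open>{0..}\<close>, \<open>{0} \<union> {s..}\<close> and
  \<open>{s..}\<close> give the three orbit conditions of the theorem, with s quantified
  outside.\<close>

definition orbits_meet :: "(real \<Rightarrow> 'e \<Rightarrow> 'e::{zero, ord}) \<Rightarrow> ('e \<Rightarrow> 'k::zero) set \<Rightarrow> real set \<Rightarrow> bool" where
  "orbits_meet T \<Phi> A \<longleftrightarrow> (\<forall>f>0. \<forall>\<phi>\<in>\<Phi>. \<phi> \<noteq> (\<lambda>_. 0) \<longrightarrow> (\<exists>t\<in>A. \<phi> (T t f) \<noteq> 0))"

lemma orbits_meetD:
  "orbits_meet T \<Phi> A \<Longrightarrow> 0 < f \<Longrightarrow> \<phi> \<in> \<Phi> \<Longrightarrow> \<phi> \<noteq> (\<lambda>_. 0) \<Longrightarrow> \<exists>t\<in>A. \<phi> (T t f) \<noteq> 0"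
  by (auto simp: orbits_meet_def)

lemma orbits_meet_mono: "orbits_meet T \<Phi> A \<Longrightarrow> A \<subseteq> B \<Longrightarrow> orbits_meet T \<Phi> B"
  unfolding orbits_meet_def by blast

section \<open>Annihilated orbits of irreducible semigroups\<close>

locale positive_C0_semigroup =
  fixes T :: "real \<Rightarrow> 'a::banach_lattice \<Rightarrow> 'a"
  assumes C0: "C0_semigroup scaleR T" and positive: "positive_semigroup T"
begin

lemma bounded_linear: "0 \<le> t \<Longrightarrow> bounded_linear (T t)"
  using C0 by (simp add: C0_semigroup_def bounded_operator_scaleR_iff)

lemma T_zero: "T 0 f = f"
  using C0 by (simp add: C0_semigroup_def)

lemma T_add: "0 \<le> s \<Longrightarrow> 0 \<le> t \<Longrightarrow> T (s + t) f = T s (T t f)"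
  using C0 by (simp add: C0_semigroup_def)

lemma strongly_continuous: "((\<lambda>t. T t f) \<longlongrightarrow> f) (at_right 0)"
  using C0 by (simp add: C0_semigroup_def)

lemma nonneg: "0 \<le> t \<Longrightarrow> 0 \<le> f \<Longrightarrow> 0 \<le> T t f"
  using positive by (simp add: positive_semigroup_def)

text \<open>Positivity of T t is applied to |f| - f and |f| + f.\<close>

lemma abs_le:
  assumes t: "0 \<le> t"
  shows "\<bar>T t f\<bar> \<le> T t \<bar>f\<bar>"
proof (rule abs_leI)
  note lin = bounded_linear.linear[OF bounded_linear[OF t]]
  show "T t f \<le> T t \<bar>f\<bar>"
    using nonneg[OF t, of "\<bar>f\<bar> - f"] by (simp add: linear_diff[OF lin] abs_ge_self)
  show "- T t f \<le> T t \<bar>f\<bar>"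
    using nonneg[OF t abs_add_self_nonneg[of f]] diff_le_eq[of 0 "T t f" "T t \<bar>f\<bar>"]
    by (simp add: linear_add[OF lin])
qed

text \<open>The hypothesis \<open>inv\<close> tests only T r |f|; since |T r f| \<le> T r |f|,
  solidity extends invariance to T r f itself, and irreducibility applies.\<close>

lemma null_ideal_dichotomy:
  fixes X :: "('a \<Rightarrow> 'c::banach_lattice) set"
  assumes irr: "irreducible_semigroup scaleR T"
    and lin: "\<And>P. P \<in> X \<Longrightarrow> bounded_linear P"
    and pos: "\<And>P f. P \<in> X \<Longrightarrow> 0 \<le> f \<Longrightarrow> 0 \<le> P f"
    and inv: "\<And>P r f. P \<in> X \<Longrightarrow> 0 \<le> r \<Longrightarrow> f \<in> null_ideal X \<Longrightarrow> P (T r \<bar>f\<bar>) = 0"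
  shows "null_ideal X = {0} \<or> null_ideal X = UNIV"
proof -
  have I: "closed_ideal scaleR (null_ideal X)"
    by (rule closed_ideal_null_ideal) (fact lin, fact pos)
  have "T r f \<in> null_ideal X" if r: "0 \<le> r" and f: "f \<in> null_ideal X" for r f
  proof (rule closed_idealD(3)[OF I])
    show "T r \<bar>f\<bar> \<in> null_ideal X"
      using inv[OF _ r f] nonneg[OF r, of "\<bar>f\<bar>"] by (simp add: null_ideal_def)
    show "\<bar>T r f\<bar> \<le> \<bar>T r \<bar>f\<bar>\<bar>"
      using abs_le[OF r, of f] nonneg[OF r, of "\<bar>f\<bar>"] by simp
  qed
  then show ?thesis
    using irr I unfolding irreducible_semigroup_def by blast
qed

lemma irreducible_imp_orbits_meet:
  assumes irr: "irreducible_semigroup scaleR T"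
  shows "orbits_meet T (positive_dual scaleR) {0..}"
  unfolding orbits_meet_def
proof (intro allI impI ballI)
  fix f :: 'a and \<phi> :: "'a \<Rightarrow> real"
  assume f: "0 < f" and \<phi>: "\<phi> \<in> positive_dual scaleR" "\<phi> \<noteq> (\<lambda>_. 0)"
  show "\<exists>t\<in>{0..}. \<phi> (T t f) \<noteq> 0"
  proof (rule ccontr)
    assume "\<not> ?thesis"
    then have null: "\<phi> (T t f) = 0" if "0 \<le> t" for t
      using that by simp
    \<comment> \<open>X is the orbit of \<phi> under the adjoints of T. Its null ideal is invariant
      because t + r is again an admissible time.\<close>
    define X where "X = (\<lambda>t f. \<phi> (T t f)) ` {0..}"
    have "null_ideal X = {0} \<or> null_ideal X = UNIV"
    proof (rule null_ideal_dichotomy[OF irr])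
      fix P
      assume "P \<in> X"
      then obtain t where t: "0 \<le> t" and P: "P = (\<lambda>f. \<phi> (T t f))"
        by (auto simp: X_def)
      show "bounded_linear P"
        unfolding P using \<phi>(1)
        by (intro bounded_linear_compose[of \<phi> "T t"] bounded_linear[OF t]) (simp add: positive_dual_scaleR_iff)
      show "0 \<le> P g" if "0 \<le> g" for g
        using \<phi>(1) nonneg[OF t that] by (simp add: P positive_dual_scaleR_iff)
      show "P (T r \<bar>g\<bar>) = 0" if r: "0 \<le> r" and g: "g \<in> null_ideal X" for r g
      proof -
        have "(\<lambda>f. \<phi> (T (t + r) f)) \<in> X"
          unfolding X_def by (rule image_eqI[of _ _ "t + r"]) (use t r in simp_all)
        from null_idealD[OF g this] show ?thesis
          by (simp add: P T_add[OF t r])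
      qed
    qed
    moreover have "f \<in> null_ideal X"
      using f null by (auto simp: null_ideal_def X_def)
    then have "null_ideal X \<noteq> {0}"
      using f by (metis less_irrefl singletonD)
    ultimately have UNIV: "null_ideal X = UNIV"
      by satx
    \<comment> \<open>The member of X at t = 0 is \<phi> itself.\<close>
    have abs_null: "\<phi> \<bar>g\<bar> = 0" for g
    proof -
      have "g \<in> null_ideal X"
        by (simp add: UNIV)
      moreover have "(\<lambda>f. \<phi> (T 0 f)) \<in> X"
        unfolding X_def by (rule image_eqI[of _ _ 0]) simp_all
      ultimately have "\<phi> (T 0 \<bar>g\<bar>) = 0"
        by (rule null_idealD)
      then show ?thesis
        by (simp only: T_zero)
    qed
    \<comment> \<open>Positivity of \<phi> on |g| + g and |g| - g traps \<phi> g between two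
      zeros.\<close>
    have "\<phi> g = 0" for g
    proof -
      have lin: "linear \<phi>"
        using \<phi>(1) by (simp add: positive_dual_scaleR_iff bounded_linear.linear)
      have "0 \<le> \<phi> (\<bar>g\<bar> + g)" "0 \<le> \<phi> (\<bar>g\<bar> - g)"
        using \<phi>(1) abs_add_self_nonneg[of g] abs_ge_self[of g] by (simp_all add: positive_dual_scaleR_iff)
      then show ?thesis
        using abs_null[of g] by (simp add: linear_add[OF lin] linear_diff[OF lin])
    qed
    then show False
      using \<phi>(2) by blast
  qed
qed

text \<open>If \<open>T s\<close> vanishes then \<open>T (s / 2)\<close> vanishes on its own range, hence vanishes by irreducibility;
  iterating contradicts strong continuity at \<open>0\<close>.\<close>

lemma irreducible_imp_pos:
  assumes irr: "irreducible_semigroup scaleR T" and f: "0 < f" and s: "0 \<le> s"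
  shows "0 < T s f"
proof -
  define K where "K r = null_ideal {T r}" for r
  have K_iff: "g \<in> K r \<longleftrightarrow> T r \<bar>g\<bar> = 0" for g r
    by (simp add: K_def null_ideal_def)
  have dich: "K r = {0} \<or> K r = UNIV" if r: "0 \<le> r" for r
    unfolding K_def
  proof (rule null_ideal_dichotomy[OF irr])
    \<comment> \<open>T r and T q commute, so T q preserves what T r annihilates.\<close>
    show "P (T q \<bar>g\<bar>) = 0" if "P \<in> {T r}" "0 \<le> q" "g \<in> null_ideal {T r}" for P q g
    proof -
      have "T r (T q \<bar>g\<bar>) = T q (T r \<bar>g\<bar>)"
        using r that by (simp add: add.commute[of q r] flip: T_add)
      also have "\<dots> = 0"
        using that by (simp add: null_ideal_def bounded_linear.linear[OF bounded_linear] linear_0)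
      finally show ?thesis
        using that by simp
    qed
  qed (use r bounded_linear nonneg in auto)
  \<comment> \<open>Were the null ideal at r / 2 trivial, T (r / 2) f would be a nonnegative member
    of it, hence 0; then f itself would be a member, against f > 0.\<close>
  have half: "K (r / 2) = UNIV" if r: "0 \<le> r" "K r = UNIV" for r
  proof (rule ccontr)
    assume "K (r / 2) \<noteq> UNIV"
    then have K0: "K (r / 2) = {0}"
      using dich[of "r / 2"] r by simp
    have nn: "0 \<le> T (r / 2) f"
      using nonneg r f by simp
    have "f \<in> K r"
      by (simp add: r)
    then have "T r f = 0"
      using f by (simp add: K_iff)
    then have "T (r / 2) (T (r / 2) f) = 0"
      using T_add[of "r / 2" "r / 2" f] r by simp
    then have "T (r / 2) f \<in> K (r / 2)"
      using nn by (simp add: K_iff)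
    then have "T (r / 2) f = 0"
      using K0 by simp
    then have "f \<in> K (r / 2)"
      using f by (simp add: K_iff)
    then show False
      using K0 f by simp
  qed
  have "T s f \<noteq> 0"
  proof
    assume 0: "T s f = 0"
    then have "f \<in> K s"
      using f by (simp add: K_iff)
    then have "K s = UNIV"
      using dich[OF s] f by (metis less_irrefl singletonD)
    then have "K (s / 2 ^ n) = UNIV" for n
    proof (induction n)
      case (Suc n)
      then show ?case
        using half[of "s / 2 ^ n"] s by (simp add: mult.commute)
    qed simp
    then have "f \<in> K (s / 2 ^ n)" for n
      by simp
    then have vanish: "T (s / 2 ^ n) f = 0" for n
      using f by (simp add: K_iff)
    \<comment> \<open>Since T 0 f = f, the time s is positive; thus s / 2^n tends to 0 through
      positive values, as \<open>at_right 0\<close> demands.\<close>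
    have "0 < s"
      using s 0 T_zero[of f] f by (cases "s = 0") auto
    moreover have "(\<lambda>n. s * (1 / 2) ^ n) \<longlonglongrightarrow> 0"
      by (intro tendsto_mult_right_zero LIMSEQ_realpow_zero) simp_all
    ultimately have "filterlim (\<lambda>n. s / 2 ^ n) (at_right 0) sequentially"
      by (simp add: filterlim_at power_divide)
    from filterlim_compose[OF strongly_continuous this, of f] have "f = 0"
      by (simp add: vanish LIMSEQ_const_iff)
    then show False
      using f by simp
  qed
  then show ?thesis
    using nonneg[OF s less_imp_le[OF f]] by simp
qed

text \<open>The orbit condition is applied to T s f > 0, and the time found is shifted by s.\<close>

lemma irreducible_imp_orbits_meet_tail:
  assumes irr: "irreducible_semigroup scaleR T" and s: "0 \<le> s"
  shows "orbits_meet T (positive_dual scaleR) {s..}"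
  unfolding orbits_meet_def
proof (intro allI impI ballI)
  fix f :: 'a and \<phi> :: "'a \<Rightarrow> real"
  assume "0 < f" "\<phi> \<in> positive_dual scaleR" "\<phi> \<noteq> (\<lambda>_. 0)"
  then obtain t where "0 \<le> t" "\<phi> (T t (T s f)) \<noteq> 0"
    using orbits_meetD[OF irreducible_imp_orbits_meet[OF irr] irreducible_imp_pos[OF irr _ s]] by auto
  then show "\<exists>t\<in>{s..}. \<phi> (T t f) \<noteq> 0"
    using s by (intro bexI[of _ "t + s"]) (simp_all add: T_add)
qed

text \<open>A functional annihilating a proper I would annihilate T t f for some f > 0 in I and all
  t in A. A general A serves both invariance from time 0 on and eventual invariance.\<close>

lemma invariant_closed_ideal_trivial:
  assumes meet: "orbits_meet T (positive_dual scaleR) A"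
    and I: "closed_ideal scaleR I" "I \<noteq> {0}" and inv: "\<And>t. t \<in> A \<Longrightarrow> T t ` I \<subseteq> I"
  shows "I = UNIV"
proof (rule ccontr)
  assume "I \<noteq> UNIV"
  then obtain \<phi> where \<phi>: "\<phi> \<in> positive_dual scaleR" "\<phi> \<noteq> (\<lambda>_. 0)" and \<phi>0: "\<And>g. g \<in> I \<Longrightarrow> \<phi> g = 0"
    using closed_ideal_separation[OF I(1)] by metis
  obtain f where f: "0 < f" "f \<in> I"
    using closed_ideal_positive_element[OF I] by metis
  then show False
    using orbits_meetD[OF meet f(1) \<phi>] \<phi>0 inv by blast
qed

section \<open>Irreducibility in terms of orbits and persistence\<close>

lemma irreducible_iff_orbits_meet:
  "irreducible_semigroup scaleR T \<longleftrightarrow> orbits_meet T (positive_dual scaleR) {0..}"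
proof
  assume meet: "orbits_meet T (positive_dual scaleR) {0..}"
  show "irreducible_semigroup scaleR T"
    unfolding irreducible_semigroup_def
  proof clarify
    fix I :: "'a set"
    assume "closed_ideal scaleR I" "I \<noteq> {0}" "I \<noteq> UNIV" "\<forall>t\<ge>0. T t ` I \<subseteq> I"
    then show False
      using invariant_closed_ideal_trivial[OF meet, of I] by simp
  qed
qed (rule irreducible_imp_orbits_meet)

lemma irreducible_iff_orbits_meet_tails:
  "irreducible_semigroup scaleR T \<longleftrightarrow> (\<forall>s\<in>{0..}. orbits_meet T (positive_dual scaleR) {s..})"
  using irreducible_imp_orbits_meet_tail irreducible_iff_orbits_meet by auto

text \<open>Enlarging the time set weakens the condition, so the tail condition implies this one;
  its instance s = 0 is the condition on all times.\<close>

lemma irreducible_iff_orbits_meet_zero_or_tails: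
  "irreducible_semigroup scaleR T \<longleftrightarrow> (\<forall>s\<in>{0..}. orbits_meet T (positive_dual scaleR) ({0} \<union> {s..}))"
proof
  assume "irreducible_semigroup scaleR T"
  then show "\<forall>s\<in>{0..}. orbits_meet T (positive_dual scaleR) ({0} \<union> {s..})"
    unfolding irreducible_iff_orbits_meet_tails by (blast intro: orbits_meet_mono)
next
  assume "\<forall>s\<in>{0..}. orbits_meet T (positive_dual scaleR) ({0} \<union> {s..})"
  then have "orbits_meet T (positive_dual scaleR) ({0} \<union> {0..})"
    by simp
  then show "irreducible_semigroup scaleR T"
    unfolding irreducible_iff_orbits_meet by (rule orbits_meet_mono) simp
qed

text \<open>An eventually invariant ideal is invariant on a tail of times, where orbits still meet
  every functional. Conversely, invariance is eventual invariance with starting time 0.\<close>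

lemma irreducible_iff_persistently_irreducible:
  "irreducible_semigroup scaleR T \<longleftrightarrow> persistently_irreducible scaleR T"
proof
  assume irr: "irreducible_semigroup scaleR T"
  show "persistently_irreducible scaleR T"
    unfolding persistently_irreducible_def uniformly_eventually_invariant_def
  proof clarify
    fix I :: "'a set" and s :: real
    assume "closed_ideal scaleR I" "I \<noteq> {0}" "I \<noteq> UNIV" "0 \<le> s" "\<forall>t\<ge>s. T t ` I \<subseteq> I"
    then show False
      using invariant_closed_ideal_trivial[OF irreducible_imp_orbits_meet_tail[OF irr], of s I] by simp
  qed
next
  assume "persistently_irreducible scaleR T"
  then show "irreducible_semigroup scaleR T"
    unfolding persistently_irreducible_def uniformly_eventually_invariant_def irreducible_semigroup_def
    by blast
qed

end

section \<open>Reduction of the complex case to the real part\<close>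

lemma linear_complexification_iff:
  "Vector_Spaces.linear scaleC scaleC F \<longleftrightarrow>
     (\<forall>z w. F (z + w) = F z + F w) \<and> (\<forall>c z. F (scaleC c z) = scaleC c (F z))"
  by (simp add: Vector_Spaces.linear_iff vector_space_scaleC)

lemma linear_complex_functional_iff:
  "Vector_Spaces.linear scaleC (*) \<phi> \<longleftrightarrow>
     (\<forall>z w. \<phi> (z + w) = \<phi> z + \<phi> w) \<and> (\<forall>c z. \<phi> (scaleC c z) = c * \<phi> z)"
proof -
  have "vector_space ((*) :: complex \<Rightarrow> complex \<Rightarrow> complex)"
    by standard (simp_all add: algebra_simps)
  then show ?thesis
    by (simp add: Vector_Spaces.linear_iff vector_space_scaleC)
qed

lemma Cplx_eq: "z = Cplx (re_part z) 0 + scaleC \<i> (Cplx (im_part z) 0)"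
  by (simp add: complexification_eq_iff)

lemma Cplx_diff: "Cplx (x - y) 0 = Cplx x 0 - Cplx y (0::'a::real_vector)"
  by (simp add: complexification_eq_iff)

lemma Cplx_add: "Cplx (x + y) 0 = Cplx x 0 + Cplx y (0::'a::real_vector)"
  by (simp add: complexification_eq_iff)

lemma Cplx_scaleR: "Cplx (r *\<^sub>R x) 0 = scaleC (of_real r) (Cplx x (0::'a::real_vector))"
  by (simp add: complexification_eq_iff)

lemma norm_Cplx_0: "norm (Cplx x 0) = norm x"
  by (simp add: norm_complexification_def modulus_Cplx_0)

lemma bounded_linear_re_part: "bounded_linear (re_part :: 'a::banach_lattice complexification \<Rightarrow> 'a)"
  by (rule bounded_linear_intro[of _ 1]) (simp_all add: norm_re_part_le)

lemma bounded_linear_im_part: "bounded_linear (im_part :: 'a::banach_lattice complexification \<Rightarrow> 'a)"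
  by (rule bounded_linear_intro[of _ 1]) (simp_all add: norm_im_part_le)

text \<open>For a positive linear F the discarded imaginary part vanishes, so this is the
  restriction of F to the real lattice.\<close>

definition real_operator :: "('a::zero complexification \<Rightarrow> 'b complexification) \<Rightarrow> 'a \<Rightarrow> 'b" where
  "real_operator F x = re_part (F (Cplx x 0))"

text \<open>A real x is the difference of the positive elements |x| + x and |x|, so F maps real
  elements to real ones; complex linearity does the rest.\<close>

lemma positive_operator_complexification:
  fixes F :: "'a::banach_lattice complexification \<Rightarrow> 'b::banach_lattice complexification"
  assumes F: "bounded_operator scaleC scaleC F" and pos: "\<And>f. 0 \<le> f \<Longrightarrow> 0 \<le> F f"
  shows "bounded_linear (real_operator F)"
    and "\<And>x. 0 \<le> x \<Longrightarrow> 0 \<le> real_operator F x"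
    and "\<And>z. F z = Cplx (real_operator F (re_part z)) (real_operator F (im_part z))"
proof -
  obtain K where add: "\<And>z w. F (z + w) = F z + F w" and scale: "\<And>c z. F (scaleC c z) = scaleC c (F z)"
    and K: "\<And>z. norm (F z) \<le> K * norm z"
    using F by (auto simp: bounded_operator_def linear_complexification_iff)
  have diff: "F (z - w) = F z - F w" for z w
    using add[of "z - w" w] by (simp add: algebra_simps)
  have nn: "im_part (F (Cplx x 0)) = 0 \<and> 0 \<le> re_part (F (Cplx x 0))" if "0 \<le> x" for x
    using pos[of "Cplx x 0"] that by (simp add: less_eq_complexification_def)
  have im: "im_part (F (Cplx x 0)) = 0" for x
  proof -
    have "im_part (F (Cplx (\<bar>x\<bar> + x - \<bar>x\<bar>) 0)) = 0"
      using nn[OF abs_add_self_nonneg[of x]] nn[of "\<bar>x\<bar>"]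
      unfolding Cplx_diff diff by simp
    then show ?thesis
      by simp
  qed
  show "bounded_linear (real_operator F)"
  proof (rule bounded_linear_intro[of _ K])
    show "norm (real_operator F x) \<le> norm x * K" for x
      using order_trans[OF norm_re_part_le K, of "Cplx x 0"]
      by (simp add: real_operator_def norm_Cplx_0 mult.commute)
  qed (simp_all add: real_operator_def Cplx_add Cplx_scaleR add scale)
  show "0 \<le> real_operator F x" if "0 \<le> x" for x
    using nn[OF that] by (simp add: real_operator_def)
  show "F z = Cplx (real_operator F (re_part z)) (real_operator F (im_part z))" for z
    by (subst Cplx_eq[of z], subst add, subst scale)
      (simp add: complexification_eq_iff real_operator_def im)
qed

text \<open>Real elements are again split into positive ones. The operator version does not apply as
  it stands, since its values lie in a complexification type and not in
  \<open>complex\<close>.\<close>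

lemma positive_dual_scaleC_iff:
  fixes \<phi> :: "'a::banach_lattice complexification \<Rightarrow> complex"
  shows "\<phi> \<in> positive_dual scaleC \<longleftrightarrow>
    (\<exists>\<psi>\<in>positive_dual scaleR. \<phi> = (\<lambda>z. Complex (\<psi> (re_part z)) (\<psi> (im_part z))))"
proof
  assume "\<phi> \<in> positive_dual scaleC"
  then obtain K where add: "\<And>z w. \<phi> (z + w) = \<phi> z + \<phi> w" and scale: "\<And>c z. \<phi> (scaleC c z) = c * \<phi> z"
    and K: "\<And>z. norm (\<phi> z) \<le> K * norm z" and pos: "\<And>f. 0 \<le> f \<Longrightarrow> \<phi> f \<in> \<real>\<^sub>\<ge>\<^sub>0"
    by (auto simp: positive_dual_def bounded_operator_def linear_complex_functional_iff)
  have diff: "\<phi> (z - w) = \<phi> z - \<phi> w" for z w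
    using add[of "z - w" w] by (simp add: algebra_simps)
  have nn: "Im (\<phi> (Cplx x 0)) = 0 \<and> 0 \<le> Re (\<phi> (Cplx x 0))" if "0 \<le> x" for x
    using pos[of "Cplx x 0"] that
    by (auto simp: less_eq_complexification_def elim!: nonneg_Reals_cases)
  have im: "Im (\<phi> (Cplx x 0)) = 0" for x
  proof -
    have "Im (\<phi> (Cplx (\<bar>x\<bar> + x - \<bar>x\<bar>) 0)) = 0"
      using nn[OF abs_add_self_nonneg[of x]] nn[of "\<bar>x\<bar>"]
      unfolding Cplx_diff diff by simp
    then show ?thesis
      by simp
  qed
  define \<psi> where "\<psi> x = Re (\<phi> (Cplx x 0))" for x
  have "bounded_linear \<psi>"
  proof (rule bounded_linear_intro[of _ K])
    show "norm (\<psi> x) \<le> norm x * K" for x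
      using order_trans[OF abs_Re_le_cmod K, of "Cplx x 0"]
      by (simp add: \<psi>_def norm_Cplx_0 mult.commute)
  qed (simp_all add: \<psi>_def Cplx_add Cplx_scaleR add scale)
  then have "\<psi> \<in> positive_dual scaleR"
    using nn by (simp add: positive_dual_scaleR_iff \<psi>_def)
  moreover have "\<phi> z = Complex (\<psi> (re_part z)) (\<psi> (im_part z))" for z
    by (subst Cplx_eq[of z], subst add, subst scale) (simp add: complex_eq_iff \<psi>_def im)
  ultimately show "\<exists>\<psi>\<in>positive_dual scaleR. \<phi> = (\<lambda>z. Complex (\<psi> (re_part z)) (\<psi> (im_part z)))"
    by blast
next
  assume "\<exists>\<psi>\<in>positive_dual scaleR. \<phi> = (\<lambda>z. Complex (\<psi> (re_part z)) (\<psi> (im_part z)))"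
  then obtain \<psi> where \<psi>: "bounded_linear \<psi>" "\<And>x. 0 \<le> x \<Longrightarrow> 0 \<le> \<psi> x"
    and \<phi>: "\<phi> = (\<lambda>z. Complex (\<psi> (re_part z)) (\<psi> (im_part z)))"
    by (auto simp: positive_dual_scaleR_iff)
  note lin = bounded_linear.linear[OF \<psi>(1)]
  have "Vector_Spaces.linear scaleC (*) \<phi>"
    unfolding linear_complex_functional_iff
    by (simp add: \<phi> complex_eq_iff linear_add[OF lin] linear_diff[OF lin] linear_scale[OF lin])
  moreover obtain K where K: "0 \<le> K" "\<And>x. norm (\<psi> x) \<le> norm x * K"
    using bounded_linear.nonneg_bounded[OF \<psi>(1)] by blast
  have "norm (\<phi> z) \<le> (K + K) * norm z" for z
  proof -
    have "norm (\<phi> z) \<le> norm (\<psi> (re_part z)) + norm (\<psi> (im_part z))"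
      using cmod_le[of "\<phi> z"] by (simp add: \<phi>)
    also have "\<dots> \<le> norm (re_part z) * K + norm (im_part z) * K"
      by (intro add_mono K(2))
    also have "\<dots> \<le> norm z * K + norm z * K"
      by (intro add_mono mult_right_mono K(1) norm_re_part_le norm_im_part_le)
    finally show ?thesis
      by (simp add: algebra_simps)
  qed
  moreover have "\<phi> f \<in> \<real>\<^sub>\<ge>\<^sub>0" if "0 \<le> f" for f
  proof -
    have "\<phi> f = of_real (\<psi> (re_part f))" "0 \<le> re_part f"
      using that linear_0[OF lin] by (auto simp: \<phi> less_eq_complexification_def complex_eq_iff)
    then show ?thesis
      using \<psi>(2) by simp
  qed
  ultimately show "\<phi> \<in> positive_dual scaleC"
    by (auto simp: positive_dual_def bounded_operator_def)
qed

section \<open>Closed ideals of the complexification\<close>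

definition cplx_ideal :: "'a set \<Rightarrow> 'a complexification set" where
  "cplx_ideal I = {z. re_part z \<in> I \<and> im_part z \<in> I}"

lemma cplx_ideal_eq_iff [simp]: "cplx_ideal I = cplx_ideal J \<longleftrightarrow> I = J"
proof
  \<comment> \<open>The diagonal element detects membership even in a set without 0.\<close>
  have "x \<in> I \<longleftrightarrow> Cplx x x \<in> cplx_ideal I" for x and I :: "'a set"
    by (simp add: cplx_ideal_def)
  then show "cplx_ideal I = cplx_ideal J \<Longrightarrow> I = J"
    by blast
qed simp

lemma cplx_ideal_zero: "cplx_ideal {0} = {0::'a::real_vector complexification}"
  by (auto simp: cplx_ideal_def complexification_eq_iff)

lemma cplx_ideal_UNIV: "cplx_ideal UNIV = UNIV"
  by (simp add: cplx_ideal_def)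

lemma abs_le_complexification_iff:
  "\<bar>z\<bar> \<le> \<bar>w\<bar> \<longleftrightarrow> modulus z \<le> modulus w" for z w :: "'a::banach_lattice complexification"
  by (simp add: abs_complexification_def less_eq_complexification_def)

lemma subspace_scaleC_iff:
  "module.subspace scaleC J \<longleftrightarrow>
     0 \<in> J \<and> (\<forall>z\<in>J. \<forall>w\<in>J. z + w \<in> J) \<and> (\<forall>c. \<forall>z\<in>J. scaleC c z \<in> J)"
  by (rule module.subspace_def) (simp add: module_iff_vector_space vector_space_scaleC)

text \<open>For solidity, both parts of f are dominated by its modulus, hence by |re g| + |im g|,
  which lies in I.\<close>

lemma closed_ideal_cplx_ideal:
  fixes I :: "'a::banach_lattice set"
  assumes I: "closed_ideal scaleR I"
  shows "closed_ideal scaleC (cplx_ideal I)"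
proof -
  note sub = closed_idealD(2)[OF I]
  have "cplx_ideal I = re_part -` I \<inter> im_part -` I"
    by (auto simp: cplx_ideal_def)
  then have "closed (cplx_ideal I)"
    using closed_idealD(1)[OF I]
    by (auto intro!: closed_Int closed_vimage linear_continuous_on bounded_linear_re_part bounded_linear_im_part)
  moreover have "module.subspace scaleC (cplx_ideal I)"
    unfolding subspace_scaleC_iff
    by (auto simp: cplx_ideal_def subspace_0[OF sub]
        intro!: subspace_add[OF sub] subspace_diff[OF sub] subspace_scale[OF sub])
  moreover have "f \<in> cplx_ideal I" if le: "modulus f \<le> modulus g" and g: "g \<in> cplx_ideal I" for f g
  proof -
    have "\<bar>re_part g\<bar> + \<bar>im_part g\<bar> \<in> I"
      using g by (intro subspace_add[OF sub]) (simp_all add: cplx_ideal_def closed_ideal_abs_iff[OF I])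
    moreover have "modulus f \<le> \<bar>\<bar>re_part g\<bar> + \<bar>im_part g\<bar>\<bar>"
      using order_trans[OF le modulus_le] by simp
    ultimately show ?thesis
      using closed_idealD(3)[OF I] order_trans[OF abs_re_part_le[of f]] order_trans[OF abs_im_part_le[of f]]
      unfolding cplx_ideal_def by blast
  qed
  ultimately show ?thesis
    unfolding closed_ideal_def abs_le_complexification_iff by blast
qed

text \<open>I collects the real elements of J. Solidity passes from z to its two parts, each
  dominated by the modulus; conversely z is recomposed from them by complex linearity.\<close>

lemma closed_ideal_scaleC_iff:
  fixes J :: "'a::banach_lattice complexification set"
  shows "closed_ideal scaleC J \<longleftrightarrow> (\<exists>I. closed_ideal scaleR I \<and> J = cplx_ideal I)"
proof
  assume J: "closed_ideal scaleC J"
  then have zero: "0 \<in> J" and add: "\<And>z w. z \<in> J \<Longrightarrow> w \<in> J \<Longrightarrow> z + w \<in> J"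
    and scale: "\<And>c z. z \<in> J \<Longrightarrow> scaleC c z \<in> J"
    and solid: "\<And>z w. modulus z \<le> modulus w \<Longrightarrow> w \<in> J \<Longrightarrow> z \<in> J" and "closed J"
    unfolding closed_ideal_def subspace_scaleC_iff abs_le_complexification_iff by blast+
  define I where "I = (\<lambda>x. Cplx x 0) -` J"
  have "bounded_linear (\<lambda>x::'a. Cplx x 0)"
    by (rule bounded_linear_intro[of _ 1]) (simp_all add: complexification_eq_iff norm_Cplx_0)
  then have "closed I"
    unfolding I_def by (intro closed_vimage[OF \<open>closed J\<close>] linear_continuous_on)
  moreover have "(0::'a complexification) = Cplx 0 0"
    by (simp add: complexification_eq_iff)
  then have "subspace I"
    using zero by (intro subspaceI) (auto simp: I_def Cplx_add Cplx_scaleR intro: add scale)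
  moreover have "x \<in> I" if "\<bar>x\<bar> \<le> \<bar>y\<bar>" "y \<in> I" for x y
    using that solid[of "Cplx x 0" "Cplx y 0"] by (simp add: I_def modulus_Cplx_0)
  ultimately have "closed_ideal scaleR I"
    unfolding closed_ideal_def subspace_scaleR_iff by blast
  moreover have "z \<in> J \<longleftrightarrow> re_part z \<in> I \<and> im_part z \<in> I" for z
  proof
    assume "z \<in> J"
    then show "re_part z \<in> I \<and> im_part z \<in> I"
      using solid[of _ z] abs_re_part_le[of z] abs_im_part_le[of z] by (simp add: I_def modulus_Cplx_0)
  next
    assume "re_part z \<in> I \<and> im_part z \<in> I"
    then show "z \<in> J"
      by (subst Cplx_eq) (simp add: I_def add scale)
  qed
  then have "J = cplx_ideal I"
    by (auto simp: cplx_ideal_def)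
  ultimately show "\<exists>I. closed_ideal scaleR I \<and> J = cplx_ideal I"
    by blast
qed (auto intro: closed_ideal_cplx_ideal)

text \<open>P stays abstract so that one equivalence serves irreducibility and persistent
  irreducibility.\<close>

lemma Bex_nontrivial_closed_ideal_scaleC:
  fixes P :: "'a::banach_lattice complexification set \<Rightarrow> bool"
  shows "(\<exists>J. closed_ideal scaleC J \<and> J \<noteq> {0} \<and> J \<noteq> UNIV \<and> P J) \<longleftrightarrow>
    (\<exists>I. closed_ideal scaleR I \<and> I \<noteq> {0} \<and> I \<noteq> UNIV \<and> P (cplx_ideal I))"
proof -
  have "cplx_ideal I \<noteq> {0} \<longleftrightarrow> I \<noteq> {0}" "cplx_ideal I \<noteq> UNIV \<longleftrightarrow> I \<noteq> UNIV" for I :: "'a set"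
    using cplx_ideal_eq_iff[of I] cplx_ideal_zero cplx_ideal_UNIV by metis+
  then show ?thesis
    unfolding closed_ideal_scaleC_iff by metis
qed

section \<open>Transfer of complex semigroups to their real parts\<close>

locale positive_complex_C0_semigroup =
  fixes S :: "real \<Rightarrow> 'b::banach_lattice complexification \<Rightarrow> 'b complexification"
  assumes C0: "C0_semigroup scaleC S" and positive: "positive_semigroup S"
begin

abbreviation "R t \<equiv> real_operator (S t)"

lemma operator:
  assumes "0 \<le> t"
  shows "bounded_linear (R t)" "\<And>x. 0 \<le> x \<Longrightarrow> 0 \<le> R t x"
    "\<And>z. S t z = Cplx (R t (re_part z)) (R t (im_part z))"
proof -
  have op: "bounded_operator scaleC scaleC (S t)"
    using C0 assms by (simp add: C0_semigroup_def)
  have pos: "0 \<le> S t f" if "0 \<le> f" for f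
    using positive assms that by (simp add: positive_semigroup_def)
  show "bounded_linear (R t)"
    by (rule positive_operator_complexification(1)) (fact op, fact pos)
  show "0 \<le> R t x" if "0 \<le> x" for x
    by (rule positive_operator_complexification(2)) (fact op, fact pos, fact that)
  show "S t z = Cplx (R t (re_part z)) (R t (im_part z))" for z
    by (rule positive_operator_complexification(3)) (fact op, fact pos)
qed

text \<open>\<open>S t\<close> acts on both parts through \<open>R t\<close>, so the semigroup law
  and strong continuity pass to R and the real equivalences become available.\<close>

sublocale positive_C0_semigroup R
proof
  show "positive_semigroup R"
    by (simp add: positive_semigroup_def operator(2))
  have "R (s + t) = R s \<circ> R t" if "0 \<le> s" "0 \<le> t" for s t
  proof
    fix x
    have "S (s + t) (Cplx x 0) = S s (S t (Cplx x 0))"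
      using C0 that by (simp add: C0_semigroup_def)
    then show "R (s + t) x = (R s \<circ> R t) x"
      using that by (simp add: operator(3))
  qed
  moreover have "R 0 = id"
    using C0 by (simp add: C0_semigroup_def real_operator_def fun_eq_iff)
  moreover have "((\<lambda>t. R t x) \<longlongrightarrow> x) (at_right 0)" for x
  proof -
    have "((\<lambda>t. S t (Cplx x 0)) \<longlongrightarrow> Cplx x 0) (at_right 0)"
      using C0 by (simp add: C0_semigroup_def)
    from bounded_linear.tendsto[OF bounded_linear_re_part this] show ?thesis
      by (simp add: real_operator_def)
  qed
  ultimately show "C0_semigroup scaleR R"
    unfolding C0_semigroup_def bounded_operator_scaleR_iff using operator(1) by blast
qed

lemma image_cplx_ideal_subset_iff:
  assumes "0 \<le> t"
  shows "S t ` cplx_ideal I \<subseteq> cplx_ideal I \<longleftrightarrow> R t ` I \<subseteq> I"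
proof
  assume S: "S t ` cplx_ideal I \<subseteq> cplx_ideal I"
  show "R t ` I \<subseteq> I"
  proof clarify
    fix x
    assume "x \<in> I"
    \<comment> \<open>With \<open>Cplx x 0\<close> one would need 0 in the arbitrary set I.\<close>
    then have "S t (Cplx x x) \<in> cplx_ideal I"
      using S by (force simp: cplx_ideal_def)
    then show "R t x \<in> I"
      by (simp add: operator(3)[OF assms] cplx_ideal_def)
  qed
qed (auto simp: operator(3)[OF assms] cplx_ideal_def)

lemma irreducible_iff: "irreducible_semigroup scaleC S \<longleftrightarrow> irreducible_semigroup scaleR R"
  unfolding irreducible_semigroup_def Bex_nontrivial_closed_ideal_scaleC
  using image_cplx_ideal_subset_iff by simp

lemma persistently_irreducible_iff:
  "persistently_irreducible scaleC S \<longleftrightarrow> persistently_irreducible scaleR R"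
proof -
  have "uniformly_eventually_invariant S (cplx_ideal I) \<longleftrightarrow> uniformly_eventually_invariant R I" for I
    unfolding uniformly_eventually_invariant_def
    using image_cplx_ideal_subset_iff by (meson order_trans)
  then show ?thesis
    unfolding persistently_irreducible_def Bex_nontrivial_closed_ideal_scaleC by simp
qed

text \<open>Positive complex elements are real and positive functionals come from real ones, so
  orbit values agree. The times lie in \<open>{0..}\<close>, where \<open>S t\<close> is described
  by \<open>R t\<close>.\<close>

lemma orbits_meet_iff:
  assumes A: "A \<subseteq> {0..}"
  shows "orbits_meet S (positive_dual scaleC) A \<longleftrightarrow> orbits_meet R (positive_dual scaleR) A"
proof -
  have ex: "(\<exists>t\<in>A. Complex (\<psi> (re_part (S t f))) (\<psi> (im_part (S t f))) \<noteq> 0) \<longleftrightarrow>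
      (\<exists>t\<in>A. \<psi> (R t (re_part f)) \<noteq> 0)"
    if \<psi>: "\<psi> \<in> positive_dual scaleR" and f: "0 < f" for \<psi> :: "'b \<Rightarrow> real" and f :: "'b complexification"
  proof (rule bex_cong[OF refl])
    fix t
    assume "t \<in> A"
    then have t: "0 \<le> t"
      using A by auto
    have "im_part f = 0"
      using f by (simp add: less_complexification_def less_eq_complexification_def)
    moreover have "\<psi> 0 = 0" "R t 0 = 0"
      using \<psi> bounded_linear.linear linear_0 operator(1)[OF t] by (auto simp: positive_dual_scaleR_iff)
    ultimately show "Complex (\<psi> (re_part (S t f))) (\<psi> (im_part (S t f))) \<noteq> 0 \<longleftrightarrow>
        \<psi> (R t (re_part f)) \<noteq> 0"
      by (simp add: operator(3)[OF t] complex_eq_iff)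
  qed
  have zero: "(\<lambda>z. Complex (\<psi> (re_part z)) (\<psi> (im_part z))) = (\<lambda>_. 0) \<longleftrightarrow> \<psi> = (\<lambda>_. 0)"
    for \<psi> :: "'b \<Rightarrow> real"
    by (auto simp: fun_eq_iff complex_eq_iff) (metis complexification.sel(1))
  have pos: "(\<forall>f>0. P (re_part f)) \<longleftrightarrow> (\<forall>x>0. P x)" for P :: "'b \<Rightarrow> bool"
  proof
    assume P: "\<forall>f>0. P (re_part f)"
    show "\<forall>x>0. P x"
    proof (intro allI impI)
      fix x :: 'b
      assume "0 < x"
      then have "0 < Cplx x 0"
        by (auto simp: less_complexification_def less_eq_complexification_def complexification_eq_iff)
      then show "P x"
        using P by force
    qed
  next
    assume "\<forall>x>0. P x"
    then show "\<forall>f>0. P (re_part f)"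
      by (auto simp: less_complexification_def less_eq_complexification_def complexification_eq_iff
          order_less_le)
  qed
  have "orbits_meet S (positive_dual scaleC) A \<longleftrightarrow>
      (\<forall>f>0. \<forall>\<psi>\<in>positive_dual scaleR. \<psi> \<noteq> (\<lambda>_. 0) \<longrightarrow>
         (\<exists>t\<in>A. Complex (\<psi> (re_part (S t f))) (\<psi> (im_part (S t f))) \<noteq> 0))"
    unfolding orbits_meet_def Ball_def positive_dual_scaleC_iff using zero by blast
  also have "\<dots> \<longleftrightarrow> (\<forall>f>0. \<forall>\<psi>\<in>positive_dual scaleR. \<psi> \<noteq> (\<lambda>_. 0) \<longrightarrow>
      (\<exists>t\<in>A. \<psi> (R t (re_part f)) \<noteq> 0))"
    using ex by blast
  also have "\<dots> \<longleftrightarrow> orbits_meet R (positive_dual scaleR) A"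
    unfolding orbits_meet_def by (rule pos)
  finally show ?thesis .
qed

end

theorem proposition3p5:
  fixes T :: "real \<Rightarrow> 'a::banach_lattice \<Rightarrow> 'a"
    and S :: "real \<Rightarrow> 'b::banach_lattice complexification \<Rightarrow> 'b complexification"
  shows
    "(C0_semigroup scaleR T \<and> positive_semigroup T \<longrightarrow>
       (irreducible_semigroup scaleR T \<longleftrightarrow>
          (\<forall>f>0. \<forall>\<phi>\<in>positive_dual scaleR. \<phi> \<noteq> (\<lambda>_. 0) \<longrightarrow>
             (\<exists>t\<in>{0..}. \<phi> (T t f) \<noteq> 0))) \<and>
       (irreducible_semigroup scaleR T \<longleftrightarrow> persistently_irreducible scaleR T) \<and>
       (irreducible_semigroup scaleR T \<longleftrightarrow>
          (\<forall>f>0. \<forall>\<phi>\<in>positive_dual scaleR. \<phi> \<noteq> (\<lambda>_. 0) \<longrightarrow>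
             (\<forall>t0\<in>{0..}. \<exists>t\<in>{0} \<union> {t0..}. \<phi> (T t f) \<noteq> 0))) \<and>
       (irreducible_semigroup scaleR T \<longleftrightarrow>
          (\<forall>f>0. \<forall>\<phi>\<in>positive_dual scaleR. \<phi> \<noteq> (\<lambda>_. 0) \<longrightarrow>
             (\<forall>t0\<in>{0..}. \<exists>t\<in>{t0..}. \<phi> (T t f) \<noteq> 0)))) \<and>
     (C0_semigroup scaleC S \<and> positive_semigroup S \<longrightarrow>
       (irreducible_semigroup scaleC S \<longleftrightarrow>
          (\<forall>f>0. \<forall>\<phi>\<in>positive_dual scaleC. \<phi> \<noteq> (\<lambda>_. 0) \<longrightarrow>
             (\<exists>t\<in>{0..}. \<phi> (S t f) \<noteq> 0))) \<and>
       (irreducible_semigroup scaleC S \<longleftrightarrow> persistently_irreducible scaleC S) \<and>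
       (irreducible_semigroup scaleC S \<longleftrightarrow>
          (\<forall>f>0. \<forall>\<phi>\<in>positive_dual scaleC. \<phi> \<noteq> (\<lambda>_. 0) \<longrightarrow>
             (\<forall>t0\<in>{0..}. \<exists>t\<in>{0} \<union> {t0..}. \<phi> (S t f) \<noteq> 0))) \<and>
       (irreducible_semigroup scaleC S \<longleftrightarrow>
          (\<forall>f>0. \<forall>\<phi>\<in>positive_dual scaleC. \<phi> \<noteq> (\<lambda>_. 0) \<longrightarrow>
             (\<forall>t0\<in>{0..}. \<exists>t\<in>{t0..}. \<phi> (S t f) \<noteq> 0))))"
proof -
  \<comment> \<open>Both rewritings, \<open>meet\<close> and \<open>meets\<close>, are polymorphic
    and fold the real and the complex half alike; \<open>meets\<close> also moves the quantifier
    over t0 outermost.\<close>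
  have meet: "(\<forall>f>0. \<forall>\<phi>\<in>\<Phi>. \<phi> \<noteq> (\<lambda>_. 0) \<longrightarrow> (\<exists>t\<in>A. \<phi> (U t f) \<noteq> 0)) \<longleftrightarrow> orbits_meet U \<Phi> A"
    for U :: "real \<Rightarrow> 'e \<Rightarrow> 'e::{zero, ord}" and \<Phi> :: "('e \<Rightarrow> 'k::zero) set" and A
    by (simp add: orbits_meet_def)
  have meets: "(\<forall>f>0. \<forall>\<phi>\<in>\<Phi>. \<phi> \<noteq> (\<lambda>_. 0) \<longrightarrow> (\<forall>t0\<in>{0..}. \<exists>t\<in>A t0. \<phi> (U t f) \<noteq> 0)) \<longleftrightarrow>
      (\<forall>t0\<in>{0..}. orbits_meet U \<Phi> (A t0))"
    for U :: "real \<Rightarrow> 'e \<Rightarrow> 'e::{zero, ord}" and \<Phi> :: "('e \<Rightarrow> 'k::zero) set" and A :: "real \<Rightarrow> real set"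
    unfolding orbits_meet_def by blast
  show ?thesis
    unfolding meet meets
  proof (intro conjI[of "_ \<longrightarrow> _"] impI; elim conjE)
    assume "C0_semigroup scaleR T" "positive_semigroup T"
    then interpret positive_C0_semigroup T
      by unfold_locales
    show "(irreducible_semigroup scaleR T \<longleftrightarrow> orbits_meet T (positive_dual scaleR) {0..}) \<and>
      (irreducible_semigroup scaleR T \<longleftrightarrow> persistently_irreducible scaleR T) \<and>
      (irreducible_semigroup scaleR T \<longleftrightarrow>
        (\<forall>t0\<in>{0..}. orbits_meet T (positive_dual scaleR) ({0} \<union> {t0..}))) \<and>
      (irreducible_semigroup scaleR T \<longleftrightarrow> (\<forall>t0\<in>{0..}. orbits_meet T (positive_dual scaleR) {t0..}))"
      using irreducible_iff_orbits_meet irreducible_iff_persistently_irreducible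
        irreducible_iff_orbits_meet_zero_or_tails irreducible_iff_orbits_meet_tails by blast
  next
    assume "C0_semigroup scaleC S" "positive_semigroup S"
    then interpret positive_complex_C0_semigroup S
      by unfold_locales
    \<comment> \<open>These inclusions discharge the premise of \<open>orbits_meet_iff\<close> for
      both kinds of time set.\<close>
    have sub: "{0} \<union> {t0..} \<subseteq> {0..}" "{t0..} \<subseteq> {0..}" if "t0 \<in> {0..}" for t0 :: real
      using that by auto
    show "(irreducible_semigroup scaleC S \<longleftrightarrow> orbits_meet S (positive_dual scaleC) {0..}) \<and>
      (irreducible_semigroup scaleC S \<longleftrightarrow> persistently_irreducible scaleC S) \<and>
      (irreducible_semigroup scaleC S \<longleftrightarrow>
        (\<forall>t0\<in>{0..}. orbits_meet S (positive_dual scaleC) ({0} \<union> {t0..}))) \<and>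
      (irreducible_semigroup scaleC S \<longleftrightarrow> (\<forall>t0\<in>{0..}. orbits_meet S (positive_dual scaleC) {t0..}))"
      unfolding irreducible_iff persistently_irreducible_iff orbits_meet_iff[OF order_refl]
      using irreducible_iff_orbits_meet irreducible_iff_persistently_irreducible
        irreducible_iff_orbits_meet_zero_or_tails irreducible_iff_orbits_meet_tails
        orbits_meet_iff[OF sub(1)] orbits_meet_iff[OF sub(2)] by simp
  qed
qed

end
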